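(* Let $z_0\in\mathcal Y$ and assume (D) and (D2). Then the solution operator $\mathcal S_s$ of $\dot z=A_s(R\ell-Qz)$, $z(0)=z_0$, is twice continuously Fréchet differentiable from $H^1(0,T;\mathcal X)$ to $H^1(0,T;\mathcal W)$. For $\ell,h_1,h_2\in H^1(0,T;\mathcal X)$, $\mathcal S_s''(\ell)[h_1,h_2]$ is the unique solution $\xi\in H^1(0,T;\mathcal W)$ of $$\dot\xi=A_s''(R\ell-Qz)[Rh_1-Q\eta_1,Rh_2-Q\eta_2]-A_s'(R\ell-Qz)Q\xi,\qquad\xi(0)=0,$$ where $z=\mathcal S_s(\ell)$ and $\eta_i=\mathcal S_s'(\ell)h_i\in H^1(0,T;\mathcal Z)$ is the solution of $\dot\eta_i=A_s'(R\ell-Qz)(Rh_i-Q\eta_i)$, $\eta_i(0)=0$. Moreover there is $C$ with $\|\mathcal S_s''(\ell)[h_1,h_2]\|_{H^1(0,T;\mathcal W)}\le C\|h_1\|_{H^1(0,T;\mathcal X)}\|h_2\|_{H^1(0,T;\mathcal X)}$ for all $\ell,h_1,h_2$.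
   Context: Fix $T>0$. $\mathcal X,\mathcal Y,\mathcal Z,\mathcal W$ are real Banach spaces and $\mathcal H$ a real separable Hilbert space with continuous embeddings $\mathcal Y\hookrightarrow\mathcal Z\hookrightarrow\mathcal H\hookrightarrow\mathcal W$. $R\in L(\mathcal X;\mathcal Y)$ and $Q\in L(\mathcal W)$ whose restrictions to $\mathcal H,\mathcal Z,\mathcal Y$ map these spaces boundedly into themselves. Assumption (D): $A_s:\mathcal Y\to\mathcal Y$ is Lipschitz continuous and Fréchet differentiable from $\mathcal Y$ to $\mathcal Z$; for each $y\in\mathcal Y$, $A_s'(y)$ extends to elements of $L(\mathcal Z;\mathcal Z)$ and of $L(\mathcal H;\mathcal H)$, and there is $C$ with $\|A_s'(y)z\|_{\mathcal Z}\le C\|z\|_{\mathcal Z}$, $\|A_s'(y)h\|_{\mathcal H}\le C\|h\|_{\mathcal H}$ for all $y,z,h$. Assumption (D2): (i) $y\mapsto A_s'(y)$ is Lipschitz continuous from $\mathcal Y$ to $L(\mathcal Z;\mathcal Z)$; each $A_s'(y)$ extends to an element of $L(\mathcal W;\mathcal W)$, $y\mapsto A_s'(y)$ is Lipschitz from $\mathcal Y$ to $L(\mathcal W;\mathcal W)$, and $\|A_s'(y)w\|_{\mathcal W}\le C\|w\|_{\mathcal W}$ for all $y\in\mathcal Y,w\in\mathcal W$; (ii) $A_s'$ is Fréchet differentiable from $\mathcal Y$ to $L(\mathcal Z;\mathcal W)$, each $A_s''(y)$ extends to an element of $L(\mathcal Z;L(\mathcal Z;\mathcal W))$, $y\mapsto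 A_s''(y)$ is continuous from $\mathcal Y$ to $L(\mathcal Z;L(\mathcal Z;\mathcal W))$, and $\|A_s''(y)[z_1,z_2]\|_{\mathcal W}\le C\|z_1\|_{\mathcal Z}\|z_2\|_{\mathcal Z}$ for all $y\in\mathcal Y$, $z_1,z_2\in\mathcal Z$. *)

theory Defs
  imports "HOL-Analysis.Analysis"
begin

text \<open>Vector-valued Sobolev space H^1(0,T;V) for an arbitrary (not necessarily separable)
real Banach space V, via strong (Bochner) measurability w.r.t. Lebesgue measure.\<close>

definition strongly_measurable_on :: "real set \<Rightarrow> (real \<Rightarrow> 'a::real_normed_vector) \<Rightarrow> bool" where
  "strongly_measurable_on I f \<longleftrightarrow>
     (\<exists>s::nat \<Rightarrow> real \<Rightarrow> 'a.
        (\<forall>n. finite (s n ` I) \<and> (\<forall>c. {t\<in>I. s n t = c} \<in> sets lebesgue)) \<and>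
        (AE t in lebesgue. t \<in> I \<longrightarrow> (\<lambda>n. s n t) \<longlonglongrightarrow> f t))"

definition L2sq :: "real \<Rightarrow> (real \<Rightarrow> 'a::real_normed_vector) \<Rightarrow> ennreal" where
  "L2sq T u = (\<integral>\<^sup>+ t. indicator {0..T} t * ennreal ((norm (u t))\<^sup>2) \<partial>lebesgue)"

text \<open>v is the (weak) time derivative of u in L^2(0,T;V), u taken as its continuous representative.\<close>
definition H1_deriv :: "real \<Rightarrow> (real \<Rightarrow> 'a::real_normed_vector) \<Rightarrow> (real \<Rightarrow> 'a) \<Rightarrow> bool" where
  "H1_deriv T u v \<longleftrightarrow>
     strongly_measurable_on {0..T} v \<and> L2sq T v < \<infinity> \<and>
     (\<forall>t\<in>{0..T}. (v has_integral (u t - u 0)) {0..t})"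

definition H1 :: "real \<Rightarrow> (real \<Rightarrow> 'a::real_normed_vector) set" where
  "H1 T = {u. \<exists>v. H1_deriv T u v}"

definition H1norm :: "real \<Rightarrow> (real \<Rightarrow> 'a::real_normed_vector) \<Rightarrow> real" where
  "H1norm T u = sqrt (enn2real (L2sq T u) + enn2real (L2sq T (SOME v. H1_deriv T u v)))"

definition eq_on :: "real \<Rightarrow> (real \<Rightarrow> 'a) \<Rightarrow> (real \<Rightarrow> 'a) \<Rightarrow> bool" where
  "eq_on T f g \<longleftrightarrow> (\<forall>t\<in>{0..T}. f t = g t)"

definition H1_linop :: "real \<Rightarrow> ((real \<Rightarrow> 'a::real_normed_vector) \<Rightarrow> (real \<Rightarrow> 'b::real_normed_vector)) \<Rightarrow> bool" where
  "H1_linop T D \<longleftrightarrow>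
     (\<forall>h\<in>H1 T. D h \<in> H1 T) \<and>
     (\<forall>h\<in>H1 T. \<forall>k\<in>H1 T. eq_on T (D (\<lambda>t. h t + k t)) (\<lambda>t. D h t + D k t)) \<and>
     (\<forall>h\<in>H1 T. \<forall>c. eq_on T (D (\<lambda>t. c *\<^sub>R h t)) (\<lambda>t. c *\<^sub>R D h t)) \<and>
     (\<exists>K. \<forall>h\<in>H1 T. H1norm T (D h) \<le> K * H1norm T h)"

definition H1_bilinop :: "real \<Rightarrow> ((real \<Rightarrow> 'a::real_normed_vector) \<Rightarrow> (real \<Rightarrow> 'a) \<Rightarrow> (real \<Rightarrow> 'b::real_normed_vector)) \<Rightarrow> bool" where
  "H1_bilinop T B \<longleftrightarrow>
     (\<forall>h\<in>H1 T. H1_linop T (B h)) \<and> (\<forall>k\<in>H1 T. H1_linop T (\<lambda>h. B h k)) \<and>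
     (\<exists>K. \<forall>h\<in>H1 T. \<forall>k\<in>H1 T. H1norm T (B h k) \<le> K * H1norm T h * H1norm T k)"

definition H1_frechet :: "real \<Rightarrow> ((real \<Rightarrow> 'a::real_normed_vector) \<Rightarrow> (real \<Rightarrow> 'b::real_normed_vector))
    \<Rightarrow> ((real \<Rightarrow> 'a) \<Rightarrow> (real \<Rightarrow> 'b)) \<Rightarrow> (real \<Rightarrow> 'a) \<Rightarrow> bool" where
  "H1_frechet T S D l \<longleftrightarrow> H1_linop T D \<and>
     (\<forall>\<epsilon>>0. \<exists>\<delta>>0. \<forall>h\<in>H1 T. H1norm T h < \<delta> \<longrightarrow>
        H1norm T (\<lambda>t. S (\<lambda>s. l s + h s) t - S l t - D h t) \<le> \<epsilon> * H1norm T h)"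

text \<open>Fr\'echet derivative at l of the operator-valued map D1 : H^1(V1) \<rightarrow> L(H^1(V1);H^1(V2)),
  measured in operator norm.\<close>
definition H1_frechet2 :: "real \<Rightarrow> ((real \<Rightarrow> 'a::real_normed_vector) \<Rightarrow> (real \<Rightarrow> 'a) \<Rightarrow> (real \<Rightarrow> 'b::real_normed_vector))
    \<Rightarrow> ((real \<Rightarrow> 'a) \<Rightarrow> (real \<Rightarrow> 'a) \<Rightarrow> (real \<Rightarrow> 'b)) \<Rightarrow> (real \<Rightarrow> 'a) \<Rightarrow> bool" where
  "H1_frechet2 T D1 D2 l \<longleftrightarrow> H1_bilinop T D2 \<and>
     (\<forall>\<epsilon>>0. \<exists>\<delta>>0. \<forall>h\<in>H1 T. H1norm T h < \<delta> \<longrightarrow>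
        (\<forall>k\<in>H1 T. H1norm T (\<lambda>t. D1 (\<lambda>s. l s + h s) k t - D1 l k t - D2 h k t)
                    \<le> \<epsilon> * H1norm T h * H1norm T k))"

definition H1_bilin_continuous :: "real \<Rightarrow> ((real \<Rightarrow> 'a::real_normed_vector) \<Rightarrow> (real \<Rightarrow> 'a) \<Rightarrow> (real \<Rightarrow> 'a) \<Rightarrow> (real \<Rightarrow> 'b::real_normed_vector)) \<Rightarrow> bool" where
  "H1_bilin_continuous T D2 \<longleftrightarrow>
     (\<forall>l\<in>H1 T. \<forall>\<epsilon>>0. \<exists>\<delta>>0. \<forall>l'\<in>H1 T. H1norm T (\<lambda>t. l' t - l t) < \<delta> \<longrightarrow>
        (\<forall>h\<in>H1 T. \<forall>k\<in>H1 T. H1norm T (\<lambda>t. D2 l' h k t - D2 l h k t)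
                    \<le> \<epsilon> * H1norm T h * H1norm T k))"

definition sol_op :: "real \<Rightarrow> ('y::real_normed_vector \<Rightarrow> 'y) \<Rightarrow> ('x::real_normed_vector \<Rightarrow>\<^sub>L 'y) \<Rightarrow> ('y \<Rightarrow>\<^sub>L 'y)
    \<Rightarrow> 'y \<Rightarrow> (real \<Rightarrow> 'x) \<Rightarrow> (real \<Rightarrow> 'y)" where
  "sol_op T A R QY z0 l = (THE z. z 0 = z0 \<and>
      H1_deriv T z (\<lambda>t. A (blinfun_apply R (l t) - blinfun_apply QY (z t))) \<and>
      (\<forall>t. t \<notin> {0..T} \<longrightarrow> z t = 0))"

end

theory Submission
  imports Defs
begin

text \<open>H1(0,T;X) embeds continuously into the continuous functions, and all the equations have
  continuous right-hand sides. So H1 solutions are classical, and it suffices to bound remainders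
  and their time derivatives in the supremum norm by powers of the supremum norm of the control
  increment; Gronwall's inequality reduces this to bounding the inhomogeneity of the linear
  equation that each remainder solves. The first remainder is quadratic in Z because \<open>A1\<close> is
  Lipschitz. The second one lives in W: subtracting the equations leaves the Taylor remainder of
  \<open>A1\<close>, controlled by the modulus of continuity of \<open>A2\<close> near the compact orbit of the argument,
  plus terms that are quadratic by the first-order estimates.

  The H1 norm chooses the weak derivative by SOME, so one also needs that weak derivatives of
  Banach-valued functions, defined through gauge integrals, are unique almost everywhere.\<close>

section \<open>Strong measurability and uniqueness of weak derivatives\<close>

text \<open>Each differentiation costs a space: the state moves in Y, its first derivative lives in
  Z, the second one only in W. The moduli of \<open>A1\<close> and \<open>A2\<close>, however, are
  measured in the norm of Y, where no derivative of the solution is available. So the argument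
  \<open>R l - Q z\<close> is shown to be Lipschitz in the control with values in Y, and only its
  linearisation is placed in Z. The extension of the second derivative to Z allows the increment of
  the argument to be exchanged for that linearisation, the error being the first remainder; the
  extension of \<open>A1\<close> to W lets the equation of the second remainder close in W. All
  Lipschitz and Gronwall constants depend on T and the data only, which makes the bound on the
  second derivative uniform in the control.\<close>

lemma strongly_measurable_on_combine:
  fixes f :: "real \<Rightarrow> 'a::real_normed_vector" and g :: "real \<Rightarrow> 'b::real_normed_vector"
    and F :: "'a \<Rightarrow> 'b \<Rightarrow> 'c::real_normed_vector"
  assumes f: "strongly_measurable_on I f" and g: "strongly_measurable_on I g"
    and F: "\<And>X Y x y. X \<longlonglongrightarrow> x \<Longrightarrow> Y \<longlonglongrightarrow> y \<Longrightarrow> (\<lambda>n::nat. F (X n) (Y n)) \<longlonglongrightarrow> F x y"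
  shows "strongly_measurable_on I (\<lambda>t. F (f t) (g t))"
proof -
  obtain s where s: "\<And>n. finite (s n ` I)" "\<And>n c. {t\<in>I. s n t = c} \<in> sets lebesgue"
      "AE t in lebesgue. t \<in> I \<longrightarrow> (\<lambda>n::nat. s n t) \<longlonglongrightarrow> f t"
    using f unfolding strongly_measurable_on_def by blast
  obtain r where r: "\<And>n. finite (r n ` I)" "\<And>n c. {t\<in>I. r n t = c} \<in> sets lebesgue"
      "AE t in lebesgue. t \<in> I \<longrightarrow> (\<lambda>n::nat. r n t) \<longlonglongrightarrow> g t"
    using g unfolding strongly_measurable_on_def by blast
  have "finite ((\<lambda>t. F (s n t) (r n t)) ` I)" for n
  proof (rule finite_subset)
    show "(\<lambda>t. F (s n t) (r n t)) ` I \<subseteq> (\<lambda>(x, y). F x y) ` (s n ` I \<times> r n ` I)"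
      by force
    show "finite ((\<lambda>(x, y). F x y) ` (s n ` I \<times> r n ` I))"
      using s(1) r(1) by blast
  qed
  \<comment> \<open>A level set of the composite is a finite union of intersections of level sets of
    the two simple functions.\<close>
  moreover have "{t\<in>I. F (s n t) (r n t) = c} \<in> sets lebesgue" for n c
  proof -
    have "{t\<in>I. F (s n t) (r n t) = c}
      = (\<Union>x\<in>s n ` I. \<Union>y\<in>{y \<in> r n ` I. F x y = c}. {t\<in>I. s n t = x} \<inter> {t\<in>I. r n t = y})"
      (is "?L = ?R")
    proof (intro equalityI subsetI)
      fix t assume "t \<in> ?L"
      then show "t \<in> ?R"
        by (intro UN_I[of "s n t"] UN_I[of "r n t"]) auto
    qed auto
    also have "\<dots> \<in> sets lebesgue"
      using s(1)[of n] r(1)[of n] s(2)[of n] r(2)[of n]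
      by (intro sets.finite_UN sets.Int) auto
    finally show ?thesis .
  qed
  moreover have "AE t in lebesgue. t \<in> I \<longrightarrow> (\<lambda>n. F (s n t) (r n t)) \<longlonglongrightarrow> F (f t) (g t)"
    using s(3) r(3) by eventually_elim (simp add: F)
  ultimately show ?thesis
    unfolding strongly_measurable_on_def by (intro exI[of _ "\<lambda>n t. F (s n t) (r n t)"]) blast
qed

lemma strongly_measurable_on_add:
  "strongly_measurable_on I f \<Longrightarrow> strongly_measurable_on I g \<Longrightarrow>
    strongly_measurable_on I (\<lambda>t. f t + g t)"
  by (rule strongly_measurable_on_combine) (auto intro: tendsto_add)

lemma strongly_measurable_on_diff:
  "strongly_measurable_on I f \<Longrightarrow> strongly_measurable_on I g \<Longrightarrow>
    strongly_measurable_on I (\<lambda>t. f t - g t)"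
  by (rule strongly_measurable_on_combine) (auto intro: tendsto_diff)

lemma strongly_measurable_on_scaleR:
  assumes "strongly_measurable_on I f"
  shows "strongly_measurable_on I (\<lambda>t. c *\<^sub>R f t)"
  by (rule strongly_measurable_on_combine[OF assms assms, of "\<lambda>x _. c *\<^sub>R x"])
    (auto intro: tendsto_scaleR)

lemma strongly_measurable_on_continuous:
  fixes f :: "real \<Rightarrow> 'a::real_normed_vector"
  assumes T: "T > 0" and f: "continuous_on {0..T} f"
  shows "strongly_measurable_on {0..T} f"
proof -
  \<comment> \<open>Left end of the grid cell of mesh \<open>T / Suc n\<close> that contains t.
    Sampling \<open>f\<close> there gives at most \<open>Suc n + 1\<close> values, the extra one at
    t = T.\<close>
  define p where "p n t = real_of_int \<lfloor>real (Suc n) * t / T\<rfloor> * T / real (Suc n)" for n t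
  have p_bounds: "0 \<le> p n t" "p n t \<le> t" "t - T / real (Suc n) \<le> p n t" if "t \<in> {0..T}" for n t
  proof -
    show "0 \<le> p n t"
      using that T unfolding p_def by (intro divide_nonneg_nonneg mult_nonneg_nonneg) auto
    have "p n t \<le> (real (Suc n) * t / T) * T / real (Suc n)"
      using T unfolding p_def by (intro divide_right_mono mult_right_mono) auto
    then show "p n t \<le> t"
      using T by simp
    have "(real (Suc n) * t / T - 1) * T / real (Suc n) \<le> p n t"
      using T real_of_int_floor_gt_diff_one[of "real (Suc n) * t / T"]
      unfolding p_def by (intro divide_right_mono mult_right_mono) auto
    moreover have "(real (Suc n) * t / T - 1) * T / real (Suc n)
        = (real (Suc n) * t / T) * T / real (Suc n) - T / real (Suc n)"
      by (simp only: left_diff_distrib diff_divide_distrib mult_1)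
    moreover have "(real (Suc n) * t / T) * T / real (Suc n) = t"
      using T by simp
    ultimately show "t - T / real (Suc n) \<le> p n t"
      by simp
  qed
  define s where "s n t = f (p n t)" for n t
  have "finite (s n ` {0..T})" for n
  proof (rule finite_subset)
    show "s n ` {0..T} \<subseteq> (\<lambda>k. f (real_of_int k * T / real (Suc n))) ` {0..int (Suc n)}"
    proof
      fix y assume "y \<in> s n ` {0..T}"
      then obtain t where t: "t \<in> {0..T}" "y = s n t" by blast
      have "real (Suc n) * t / T \<le> real (Suc n)"
        using t T by (simp add: divide_le_eq mult_left_mono del: of_nat_Suc)
      then have "\<lfloor>real (Suc n) * t / T\<rfloor> \<le> int (Suc n)"
        by linarith
      then have "\<lfloor>real (Suc n) * t / T\<rfloor> \<in> {0..int (Suc n)}"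
        using t T by simp
      then show "y \<in> (\<lambda>k. f (real_of_int k * T / real (Suc n))) ` {0..int (Suc n)}"
        using t unfolding s_def p_def by blast
    qed
  qed auto
  moreover have "{t\<in>{0..T}. s n t = c} \<in> sets lebesgue" for n c
  proof -
    have "(\<lambda>t. \<lfloor>real (Suc n) * t / T\<rfloor>) \<in> measurable borel (count_space UNIV)"
      by measurable
    then have "(\<lambda>t. \<lfloor>real (Suc n) * t / T\<rfloor>) -` {k. f (real_of_int k * T / real (Suc n)) = c} \<inter> space borel
        \<in> sets borel"
      by (rule measurable_sets) auto
    then have "((\<lambda>t. \<lfloor>real (Suc n) * t / T\<rfloor>) -` {k. f (real_of_int k * T / real (Suc n)) = c}) \<inter> {0..T}
        \<in> sets borel"
      by auto
    moreover have "{t\<in>{0..T}. s n t = c}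
        = ((\<lambda>t. \<lfloor>real (Suc n) * t / T\<rfloor>) -` {k. f (real_of_int k * T / real (Suc n)) = c}) \<inter> {0..T}"
      by (auto simp: s_def p_def)
    ultimately show ?thesis
      by (simp add: sets_completionI_sets)
  qed
  moreover have "(\<lambda>n. s n t) \<longlonglongrightarrow> f t" if t: "t \<in> {0..T}" for t
  proof -
    have "(\<lambda>n. T / real (Suc n)) \<longlonglongrightarrow> 0"
      by (rule LIMSEQ_Suc[OF lim_const_over_n])
    from tendsto_diff[OF tendsto_const this] have "(\<lambda>n. t - T / real (Suc n)) \<longlonglongrightarrow> t"
      by simp
    then have "(\<lambda>n. p n t) \<longlonglongrightarrow> t"
      by (rule tendsto_sandwich[OF always_eventually[OF allI[OF p_bounds(3)[OF t]]]
            always_eventually[OF allI[OF p_bounds(2)[OF t]]] _ tendsto_const])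
    moreover have "p n t \<in> {0..T}" for n
      using p_bounds(1,2)[OF t, of n] t by simp
    ultimately show ?thesis
      unfolding s_def using t by (intro continuous_on_tendsto_compose[OF f]) simp_all
  qed
  ultimately show ?thesis
    unfolding strongly_measurable_on_def by blast
qed

text \<open>The norm is all that \<open>L2sq\<close> looks at, and the norm of a simple function is
  a finite combination of indicators.\<close>

lemma strongly_measurable_on_norm_borel:
  fixes f :: "real \<Rightarrow> 'a::real_normed_vector"
  assumes f: "strongly_measurable_on I f" and I: "I \<in> sets lebesgue"
  shows "(\<lambda>t. indicator I t * norm (f t)) \<in> borel_measurable lebesgue"
proof -
  obtain s where s: "\<And>n. finite (s n ` I)" "\<And>n c. {t\<in>I. s n t = c} \<in> sets lebesgue"
      "AE t in lebesgue. t \<in> I \<longrightarrow> (\<lambda>n::nat. s n t) \<longlonglongrightarrow> f t"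
    using f unfolding strongly_measurable_on_def by blast
  have meas: "(\<lambda>t. indicator I t * norm (s n t) :: real) \<in> borel_measurable lebesgue" for n
  proof -
    have "(\<lambda>t. indicator I t * norm (s n t))
        = (\<lambda>t. \<Sum>c\<in>s n ` I. norm c * indicator {t\<in>I. s n t = c} t)"
    proof
      fix t show "indicator I t * norm (s n t) = (\<Sum>c\<in>s n ` I. norm c * indicator {t\<in>I. s n t = c} t)"
      proof (cases "t \<in> I")
        case True
        have "(\<Sum>c\<in>s n ` I. norm c * indicator {t\<in>I. s n t = c} t)
            = (\<Sum>c\<in>s n ` I. if c = s n t then norm c else 0)"
          using True by (intro sum.cong) (auto simp: indicator_def)
        also have "\<dots> = norm (s n t)"
          using True s(1) by simp
        finally show ?thesis using True by simp
      qed (auto simp: indicator_def)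
    qed
    then show ?thesis
      using s(2) by (auto intro!: borel_measurable_sum borel_measurable_times)
  qed
  obtain N where N: "N \<in> null_sets lebesgue"
      "\<And>t. t \<notin> N \<Longrightarrow> t \<in> I \<Longrightarrow> (\<lambda>n. s n t) \<longlonglongrightarrow> f t"
    using s(3) by (auto elim!: AE_E3)
  \<comment> \<open>Cutting out the null set gives convergence everywhere; completeness of Lebesgue
    measure restores it afterwards.\<close>
  have "(\<lambda>t. indicator (- N) t * (indicator I t * norm (f t))) \<in> borel_measurable lebesgue"
  proof (rule borel_measurable_LIMSEQ_real)
    show "(\<lambda>n. indicator (- N) t * (indicator I t * norm (s n t))) \<longlonglongrightarrow>
        indicator (- N) t * (indicator I t * norm (f t))" for t
      using N(2)[of t] by (cases "t \<in> N"; cases "t \<in> I") (auto intro: tendsto_norm)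
    show "(\<lambda>t. indicator (- N) t * (indicator I t * norm (s n t)) :: real) \<in> borel_measurable lebesgue" for n
      by (intro borel_measurable_times[OF borel_measurable_indicator meas])
        (use null_setsD2[OF N(1)] in \<open>simp add: Compl_in_sets_lebesgue\<close>)
  qed
  then show ?thesis
    by (rule borel_measurable_AE) (use AE_not_in[OF N(1)] in eventually_elim, auto)
qed

text \<open>A Vitali-type cover of the set by gauge-fine intervals has, by Henstock's lemma, small
  total length, since on it the Riemann sums cannot cancel. This replaces testing with
  functionals.\<close>

lemma negligible_near_value:
  fixes w :: "real \<Rightarrow> 'a::banach"
  assumes T: "T > 0" and w: "\<And>t. t \<in> {0..T} \<Longrightarrow> (w has_integral 0) {0..t}"
  shows "negligible {t\<in>{0..T}. norm (w t - c) < norm c / 2}"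
proof (cases "c = 0")
  case False
  define E where "E = {t\<in>{0..T}. norm (w t - c) < norm c / 2}"
  have c: "norm c > 0" using False by simp
  have int: "w integrable_on cbox 0 T"
    using w[of T] T by (auto simp: integrable_on_def)
  \<comment> \<open>Since interval integrals vanish, Henstock's lemma bounds the tagged sum
    itself.\<close>
  have zero: "integral K w = 0" if "K \<subseteq> {0..T}" "K = cbox a b" for K a b
  proof (cases "a \<le> b")
    case True
    then have "0 \<le> a" "b \<le> T" using that by auto
    then have "integral {0..a} w + integral {a..b} w = integral {0..b} w"
      using True int by (intro Henstock_Kurzweil_Integration.integral_combine)
        (auto intro: integrable_on_subinterval)
    then show ?thesis
      using w[of a] w[of b] True \<open>0 \<le> a\<close> \<open>b \<le> T\<close> that by (simp add: integral_unique)
  qed (use that in auto)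
  have "\<exists>S. E \<subseteq> S \<and> S \<in> lmeasurable \<and> measure lebesgue S \<le> e" if e: "e > 0" for e
  proof -
    \<comment> \<open>The tags lie in \<open>E\<close>, so a finite family of total length m has a
      tagged sum of norm at least m * norm c / 2; bounding that sum by \<open>d\<close> gives m at
      most \<open>e\<close>.\<close>
    define d where "d = e * norm c / 2"
    have d: "d > 0" using e c by (simp add: d_def)
    obtain \<gamma> where \<gamma>: "gauge \<gamma>" "\<And>p. p tagged_division_of cbox 0 T \<Longrightarrow> \<gamma> fine p \<Longrightarrow>
        norm ((\<Sum>(x,K)\<in>p. measure lborel K *\<^sub>R w x) - integral (cbox 0 T) w) < d"
      using has_integralD[OF integrable_integral[OF int] d] by metis
    have "E \<subseteq> cbox 0 T" "box 0 T \<noteq> {}" using T by (auto simp: E_def)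
    then obtain \<D> where \<D>: "countable \<D>" "\<Union>\<D> \<subseteq> cbox 0 T"
        "\<And>K. K \<in> \<D> \<Longrightarrow> interior K \<noteq> {} \<and> (\<exists>c d. K = cbox c d)"
        "pairwise (\<lambda>A B. interior A \<inter> interior B = {}) \<D>"
        "\<And>K. K \<in> \<D> \<Longrightarrow> \<exists>x \<in> E \<inter> K. K \<subseteq> \<gamma> x" "E \<subseteq> \<Union>\<D>"
      using covering_lemma[OF _ _ \<gamma>(1), of E 0 T] by metis
    obtain x where x: "\<And>K. K \<in> \<D> \<Longrightarrow> x K \<in> E \<inter> K \<and> K \<subseteq> \<gamma> (x K)"
      using \<D>(5) by metis
    \<comment> \<open>Henstock's lemma speaks of finite families; a bound uniform over them passes
      to the countable union.\<close>
    have bound: "measure lebesgue (\<Union>\<F>) \<le> e" if \<F>: "\<F> \<subseteq> \<D>" "finite \<F>" for \<F>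
    proof -
      let ?p = "(\<lambda>K. (x K, K)) ` \<F>"
      have inj: "inj_on (\<lambda>K. (x K, K)) \<F>" by (auto simp: inj_on_def)
      have "?p tagged_partial_division_of cbox 0 T"
        unfolding tagged_partial_division_of_def
      proof (intro conjI allI impI)
        show "finite ?p" using \<F> by simp
        fix y K assume "(y, K) \<in> ?p"
        then have K: "K \<in> \<D>" "y = x K" using \<F> by auto
        show "y \<in> K" using x K by blast
        show "K \<subseteq> cbox 0 T" using K \<D>(2) by blast
        show "\<exists>a b. K = cbox a b" using K \<D>(3) by blast
      next
        fix y1 K1 y2 K2 assume "(y1, K1) \<in> ?p \<and> (y2, K2) \<in> ?p \<and> (y1, K1) \<noteq> (y2, K2)"
        then have "K1 \<in> \<D>" "K2 \<in> \<D>" "K1 \<noteq> K2" using \<F> by auto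
        then show "interior K1 \<inter> interior K2 = {}"
          using \<D>(4) by (auto simp: pairwise_def)
      qed
      moreover have "\<gamma> fine ?p"
        using x \<F> by (auto simp: fine_def)
      ultimately have "norm (\<Sum>(y,K)\<in>?p. measure lborel K *\<^sub>R w y - integral K w) \<le> d"
        using \<gamma>(2) by (intro Henstock_lemma_part1[OF int d \<gamma>(1)])
      moreover have "(\<Sum>(y,K)\<in>?p. measure lborel K *\<^sub>R w y - integral K w)
          = (\<Sum>K\<in>\<F>. measure lborel K *\<^sub>R w (x K))"
        unfolding sum.reindex[OF inj] o_def prod.case
      proof (rule sum.cong)
        fix K assume "K \<in> \<F>"
        then have "K \<in> \<D>" using \<F> by blast
        then obtain a b where "K = cbox a b" "K \<subseteq> {0..T}" using \<D>(2,3)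
          by (metis Union_upper box_real(2) order_trans)
        then show "measure lborel K *\<^sub>R w (x K) - integral K w = measure lborel K *\<^sub>R w (x K)"
          using zero by simp
      qed simp
      ultimately have le_d: "norm (\<Sum>K\<in>\<F>. measure lborel K *\<^sub>R w (x K)) \<le> d" by simp
      let ?M = "\<Sum>K\<in>\<F>. measure lborel K"
      have M: "?M \<ge> 0" by (simp add: sum_nonneg)
      have "?M * norm c = norm (\<Sum>K\<in>\<F>. measure lborel K *\<^sub>R c)"
        using M by (simp add: scaleR_left.sum[symmetric])
      also have "(\<Sum>K\<in>\<F>. measure lborel K *\<^sub>R c)
          = (\<Sum>K\<in>\<F>. measure lborel K *\<^sub>R w (x K)) - (\<Sum>K\<in>\<F>. measure lborel K *\<^sub>R (w (x K) - c))"
        by (simp add: sum_subtractf[symmetric] scaleR_diff_right)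
      also have "norm \<dots> \<le> d + (\<Sum>K\<in>\<F>. norm (measure lborel K *\<^sub>R (w (x K) - c)))"
        by (intro norm_triangle_le_diff add_mono le_d norm_sum)
      also have "(\<Sum>K\<in>\<F>. norm (measure lborel K *\<^sub>R (w (x K) - c))) \<le> (\<Sum>K\<in>\<F>. measure lborel K * (norm c / 2))"
      proof (rule sum_mono)
        fix K assume "K \<in> \<F>"
        then have "x K \<in> E" using x \<F> by blast
        then have "norm (w (x K) - c) \<le> norm c / 2" by (simp add: E_def)
        then show "norm (measure lborel K *\<^sub>R (w (x K) - c)) \<le> measure lborel K * (norm c / 2)"
          unfolding norm_scaleR abs_of_nonneg[OF measure_nonneg]
          by (rule mult_left_mono) simp
      qed
      also have "\<dots> = ?M * norm c / 2" by (simp add: sum_distrib_right sum_divide_distrib)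
      finally have "?M * norm c \<le> 2 * d" by simp
      then have "?M \<le> e" using c by (simp add: d_def)
      moreover have "measure lebesgue (\<Union>\<F>) \<le> (\<Sum>K\<in>\<F>. measure lebesgue K)"
      proof (rule measure_Union_le[OF \<F>(2)])
        fix K assume "K \<in> \<F>"
        then obtain a b where "K = cbox a b" using \<D>(3) \<F> by blast
        then show "K \<in> sets lebesgue" by simp
      qed
      moreover have "(\<Sum>K\<in>\<F>. measure lebesgue K) = ?M"
      proof (rule sum.cong)
        fix K assume "K \<in> \<F>"
        then obtain a b where "K = cbox a b" using \<D>(3) \<F> by blast
        then show "measure lebesgue K = measure lborel K" by simp
      qed simp
      ultimately show ?thesis by simp
    qed
    have lm: "K \<in> lmeasurable" if "K \<in> \<D>" for K
      using \<D>(3)[OF that] by (auto simp: lmeasurable_cbox)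
    have "\<Union>\<D> \<in> lmeasurable" "measure lebesgue (\<Union>\<D>) \<le> e"
      using fmeasurable_UN_bound[OF \<D>(1), of "\<lambda>x. x" lebesgue e]
        measure_UN_bound[OF \<D>(1), of "\<lambda>x. x" lebesgue e] bound lm by auto
    then show ?thesis using \<D>(6) by blast
  qed
  then show ?thesis unfolding negligible_outer_le E_def by blast
qed auto

text \<open>The values of the simple approximants form a countable set that comes arbitrarily close
  to \<open>w t\<close> for almost every t. Where \<open>w t\<close> is nonzero, some such value c
  lies within \<open>norm c / 2\<close> of it, and for each c this happens on a null set
  only.\<close>

lemma AE_zero_of_integral_zero:
  fixes w :: "real \<Rightarrow> 'a::banach"
  assumes T: "T > 0" and meas: "strongly_measurable_on {0..T} w"
    and w: "\<And>t. t \<in> {0..T} \<Longrightarrow> (w has_integral 0) {0..t}"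
  shows "AE t in lebesgue. t \<in> {0..T} \<longrightarrow> w t = 0"
proof -
  obtain s where s: "\<And>n. finite (s n ` {0..T})"
      "AE t in lebesgue. t \<in> {0..T} \<longrightarrow> (\<lambda>n::nat. s n t) \<longlonglongrightarrow> w t"
    using meas unfolding strongly_measurable_on_def by blast
  define D where "D = (\<Union>n. s n ` {0..T})"
  have "countable D"
    using s(1) unfolding D_def by (auto intro: countable_finite)
  have "negligible (\<Union>c\<in>D. {t\<in>{0..T}. norm (w t - c) < norm c / 2})"
    using \<open>countable D\<close> negligible_near_value[OF T w] by (intro negligible_countable_Union) auto
  then have "AE t in lebesgue. t \<notin> (\<Union>c\<in>D. {t\<in>{0..T}. norm (w t - c) < norm c / 2})"
    by (intro AE_not_in) (simp add: negligible_iff_null_sets)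
  with s(2) show ?thesis
  proof eventually_elim
    case (elim t)
    show ?case
    proof (intro impI, rule ccontr)
      assume t: "t \<in> {0..T}" and nz: "w t \<noteq> 0"
      \<comment> \<open>With this tolerance the approximant keeps 3/4 of the norm of
        \<open>w t\<close>, so the error is below half of the approximant's own norm.\<close>
      then have "eventually (\<lambda>n. dist (s n t) (w t) < norm (w t) / 4) sequentially"
        using elim(1) by (intro tendstoD) auto
      then obtain n where "norm (s n t - w t) < norm (w t) / 4"
        by (auto simp: eventually_sequentially dist_norm)
      then have "norm (w t - s n t) < norm (s n t) / 2"
        using norm_triangle_ineq2[of "w t" "s n t"] norm_ge_zero[of "w t"]
        unfolding norm_minus_commute[of "s n t"] by linarith
      moreover have "s n t \<in> D" using t unfolding D_def by blast
      ultimately show False using elim(2) t by blast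
    qed
  qed
qed

section \<open>The space H1 and its embedding into the continuous functions\<close>

lemma L2sq_measurable:
  assumes "strongly_measurable_on {0..T} v"
  shows "(\<lambda>t. indicator {0..T} t * ennreal ((norm (v t))\<^sup>2)) \<in> borel_measurable lebesgue"
proof -
  have "(\<lambda>t. ennreal ((indicator {0..T} t * norm (v t))\<^sup>2)) \<in> borel_measurable lebesgue"
    using strongly_measurable_on_norm_borel[OF assms lmeasurable_interval(1)[THEN fmeasurableD]]
    by measurable
  also have "(\<lambda>t. ennreal ((indicator {0..T} t * norm (v t))\<^sup>2))
      = (\<lambda>t. indicator {0..T} t * ennreal ((norm (v t))\<^sup>2))"
    by (auto simp: indicator_def)
  finally show ?thesis .
qed

text \<open>Bridge between the Lebesgue integral in \<open>L2sq\<close> and the gauge integral in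
  \<open>H1_deriv\<close>; the two meet in \<open>H1_sup_bound\<close>.\<close>

lemma L2sq_has_integral:
  assumes "strongly_measurable_on {0..T} v" "L2sq T v < \<infinity>"
  shows "((\<lambda>t. (norm (v t))\<^sup>2) has_integral enn2real (L2sq T v)) {0..T}"
proof -
  let ?F = "\<lambda>t. (indicator {0..T} t * norm (v t))\<^sup>2"
  have F: "?F \<in> borel_measurable lebesgue"
    using strongly_measurable_on_norm_borel[OF assms(1) lmeasurable_interval(1)[THEN fmeasurableD]]
    by measurable
  have eq: "(\<integral>\<^sup>+ t. ennreal (?F t) \<partial>lebesgue) = L2sq T v"
    unfolding L2sq_def by (rule nn_integral_cong) (auto simp: indicator_def)
  have "integrable lebesgue ?F"
    using F assms(2) eq by (intro integrableI_nonneg) auto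
  moreover have "integral\<^sup>L lebesgue ?F = enn2real (L2sq T v)"
    using F eq by (subst integral_eq_nn_integral) auto
  ultimately have "(?F has_integral enn2real (L2sq T v)) UNIV"
    using has_integral_integral_lebesgue by metis
  moreover have "?F = (\<lambda>t. if t \<in> {0..T} then (norm (v t))\<^sup>2 else 0)"
    by (auto simp: indicator_def)
  ultimately show ?thesis
    by (simp only: has_integral_restrict_UNIV)
qed

lemma L2sq_le:
  assumes "T \<ge> 0" "\<And>t. t \<in> {0..T} \<Longrightarrow> norm (u t) \<le> M"
  shows "L2sq T u \<le> ennreal (T * M\<^sup>2)"
proof -
  have "L2sq T u \<le> (\<integral>\<^sup>+ t. ennreal (M\<^sup>2) * indicator {0..T} t \<partial>lebesgue)"
    unfolding L2sq_def
  proof (rule nn_integral_mono)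
    fix t show "indicator {0..T} t * ennreal ((norm (u t))\<^sup>2) \<le> ennreal (M\<^sup>2) * indicator {0..T} t"
      using assms(2)[of t] by (cases "t \<in> {0..T}") (auto intro!: ennreal_leI power_mono)
  qed
  also have "\<dots> = ennreal (T * M\<^sup>2)"
    using assms(1) by (subst nn_integral_cmult_indicator) (auto simp: ennreal_mult'[symmetric] mult.commute)
  finally show ?thesis .
qed

lemma L2sq_add_finite:
  assumes v: "strongly_measurable_on {0..T} v" "L2sq T v < \<infinity>"
    and w: "strongly_measurable_on {0..T} w" "L2sq T w < \<infinity>"
  shows "L2sq T (\<lambda>t. v t + w t) < \<infinity>"
proof -
  let ?F = "\<lambda>v t. indicator {0..T} t * ennreal ((norm (v t))\<^sup>2)"
  have "L2sq T (\<lambda>t. v t + w t) \<le> (\<integral>\<^sup>+ t. 2 * (?F v t + ?F w t) \<partial>lebesgue)"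
    unfolding L2sq_def
  proof (rule nn_integral_mono)
    fix t
    have "(norm (v t + w t))\<^sup>2 \<le> (norm (v t) + norm (w t))\<^sup>2"
      by (intro power_mono norm_triangle_ineq) auto
    also have "\<dots> \<le> 2 * ((norm (v t))\<^sup>2 + (norm (w t))\<^sup>2)"
      using sum_squares_ge_zero[of "norm (v t) - norm (w t)" 0]
      by (simp add: power2_eq_square algebra_simps)
    finally have "ennreal ((norm (v t + w t))\<^sup>2) \<le> ennreal (2 * ((norm (v t))\<^sup>2 + (norm (w t))\<^sup>2))"
      by (rule ennreal_leI)
    also have "\<dots> = 2 * (ennreal ((norm (v t))\<^sup>2) + ennreal ((norm (w t))\<^sup>2))"
      by (simp add: ennreal_mult'' ennreal_mult')
    finally show "indicator {0..T} t * ennreal ((norm (v t + w t))\<^sup>2) \<le> 2 * (?F v t + ?F w t)"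
      by (auto simp: indicator_def)
  qed
  also have "\<dots> = 2 * (L2sq T v + L2sq T w)"
    using L2sq_measurable[OF v(1)] L2sq_measurable[OF w(1)] unfolding L2sq_def
    by (subst nn_integral_cmult, measurable) (subst nn_integral_add, auto)
  also have "\<dots> < \<infinity>"
    using v(2) w(2) by (simp add: ennreal_mult_less_top)
  finally show ?thesis .
qed

lemma L2sq_scaleR_finite:
  assumes v: "strongly_measurable_on {0..T} v" "L2sq T v < \<infinity>"
  shows "L2sq T (\<lambda>t. c *\<^sub>R v t) < \<infinity>"
proof -
  let ?F = "\<lambda>v t. indicator {0..T} t * ennreal ((norm (v t))\<^sup>2)"
  have "L2sq T (\<lambda>t. c *\<^sub>R v t) = (\<integral>\<^sup>+ t. ennreal (c\<^sup>2) * ?F v t \<partial>lebesgue)"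
    unfolding L2sq_def
    by (rule nn_integral_cong) (auto simp: indicator_def power_mult_distrib ennreal_mult')
  also have "\<dots> = ennreal (c\<^sup>2) * L2sq T v"
    using L2sq_measurable[OF v(1)] unfolding L2sq_def by (rule nn_integral_cmult)
  also have "\<dots> < \<infinity>"
    using v(2) by (simp add: ennreal_mult_less_top)
  finally show ?thesis .
qed

lemma H1_derivD:
  assumes "H1_deriv T u v" "t \<in> {0..T}"
  shows "(v has_integral (u t - u 0)) {0..t}"
  using assms by (auto simp: H1_deriv_def)

text \<open>A continuous derivative is bounded on the compact interval, hence square integrable.
  This is how the solutions constructed below enter \<open>H1\<close>.\<close>

lemma H1_derivI:
  assumes T: "T > 0" and v: "continuous_on {0..T} v"
    and int: "\<And>t. t \<in> {0..T} \<Longrightarrow> (v has_integral (u t - u 0)) {0..t}"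
  shows "H1_deriv T u v"
proof -
  have "compact (v ` {0..T})"
    using v by (rule compact_continuous_image) auto
  then obtain M where "\<And>t. t \<in> {0..T} \<Longrightarrow> norm (v t) \<le> M"
    using compact_imp_bounded by (force simp: bounded_iff)
  then have "L2sq T v \<le> ennreal (T * M\<^sup>2)"
    using T by (intro L2sq_le) auto
  then have "L2sq T v < \<infinity>"
    using le_less_trans ennreal_less_top by (metis infinity_ennreal_def)
  then show ?thesis
    unfolding H1_deriv_def using strongly_measurable_on_continuous[OF T v] int by blast
qed

lemma H1_deriv_add:
  assumes "H1_deriv T u v" "H1_deriv T u' v'"
  shows "H1_deriv T (\<lambda>t. u t + u' t) (\<lambda>t. v t + v' t)"
  unfolding H1_deriv_def
proof (intro conjI ballI)
  show "strongly_measurable_on {0..T} (\<lambda>t. v t + v' t)" "L2sq T (\<lambda>t. v t + v' t) < \<infinity>"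
    using assms unfolding H1_deriv_def by (blast intro: strongly_measurable_on_add L2sq_add_finite)+
  fix t assume "t \<in> {0..T}"
  from has_integral_add[OF H1_derivD[OF assms(1) this] H1_derivD[OF assms(2) this]]
  show "((\<lambda>t. v t + v' t) has_integral (u t + u' t - (u 0 + u' 0))) {0..t}"
    by (simp add: algebra_simps)
qed

lemma H1_deriv_scaleR:
  assumes "H1_deriv T u v"
  shows "H1_deriv T (\<lambda>t. c *\<^sub>R u t) (\<lambda>t. c *\<^sub>R v t)"
  unfolding H1_deriv_def
proof (intro conjI ballI)
  show "strongly_measurable_on {0..T} (\<lambda>t. c *\<^sub>R v t)" "L2sq T (\<lambda>t. c *\<^sub>R v t) < \<infinity>"
    using assms unfolding H1_deriv_def
    by (blast intro: strongly_measurable_on_scaleR L2sq_scaleR_finite)+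
  fix t assume "t \<in> {0..T}"
  from has_integral_cmul[OF H1_derivD[OF assms(1) this], of c]
  show "((\<lambda>t. c *\<^sub>R v t) has_integral (c *\<^sub>R u t - c *\<^sub>R u 0)) {0..t}"
    by (simp add: scaleR_diff_right)
qed

lemma H1_deriv_diff:
  assumes "H1_deriv T u v" "H1_deriv T u' v'"
  shows "H1_deriv T (\<lambda>t. u t - u' t) (\<lambda>t. v t - v' t)"
  using H1_deriv_add[OF assms(1) H1_deriv_scaleR[OF assms(2), of "-1"]] by simp

lemma H1_add: "h \<in> H1 T \<Longrightarrow> k \<in> H1 T \<Longrightarrow> (\<lambda>t. h t + k t) \<in> H1 T"
  unfolding H1_def using H1_deriv_add by blast

lemma H1_diff: "h \<in> H1 T \<Longrightarrow> k \<in> H1 T \<Longrightarrow> (\<lambda>t. h t - k t) \<in> H1 T"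
  unfolding H1_def using H1_deriv_diff by blast

lemma H1_scaleR: "h \<in> H1 T \<Longrightarrow> (\<lambda>t. c *\<^sub>R h t) \<in> H1 T"
  unfolding H1_def using H1_deriv_scaleR by blast

section \<open>Continuous representatives, the H1 norm and the supremum bound\<close>

lemma H1_deriv_continuous_on:
  fixes u :: "real \<Rightarrow> 'a::banach"
  assumes T: "T \<ge> 0" and u: "H1_deriv T u v"
  shows "continuous_on {0..T} u"
proof -
  have "v integrable_on {0..T}"
    using H1_derivD[OF u, of T] T by auto
  then have "continuous_on {0..T} (\<lambda>t. u 0 + integral {0..t} v)"
    by (intro continuous_intros indefinite_integral_continuous_1)
  also have "?this \<longleftrightarrow> ?thesis"
    by (rule continuous_on_cong) (auto simp: integral_unique[OF H1_derivD[OF u]])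
  finally show ?thesis .
qed

lemma H1_continuous_on:
  fixes u :: "real \<Rightarrow> 'a::banach"
  shows "T \<ge> 0 \<Longrightarrow> u \<in> H1 T \<Longrightarrow> continuous_on {0..T} u"
  using H1_deriv_continuous_on[of T u] unfolding H1_def by blast

lemma H1norm_nonneg: "H1norm T u \<ge> 0"
  by (simp add: H1norm_def)

text \<open>Two weak derivatives differ by a function whose integrals over all \<open>{0..t}\<close>
  vanish, so \<open>L2sq\<close> cannot see which one SOME picks.\<close>

lemma H1norm_eq:
  fixes u :: "real \<Rightarrow> 'a::banach"
  assumes T: "T > 0" and u: "H1_deriv T u v"
  shows "H1norm T u = sqrt (enn2real (L2sq T u) + enn2real (L2sq T v))"
proof -
  define w where "w = (SOME v. H1_deriv T u v)"
  have w: "H1_deriv T u w"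
    unfolding w_def by (rule someI[of "H1_deriv T u", OF u])
  have "AE t in lebesgue. t \<in> {0..T} \<longrightarrow> w t - v t = 0"
  proof (rule AE_zero_of_integral_zero[OF T])
    show "strongly_measurable_on {0..T} (\<lambda>t. w t - v t)"
      using u w by (auto simp: H1_deriv_def intro: strongly_measurable_on_diff)
    fix t assume "t \<in> {0..T}"
    from has_integral_diff[OF H1_derivD[OF w this] H1_derivD[OF u this]]
    show "((\<lambda>t. w t - v t) has_integral 0) {0..t}" by simp
  qed
  then have "AE t in lebesgue. indicator {0..T} t * ennreal ((norm (w t))\<^sup>2)
      = indicator {0..T} t * ennreal ((norm (v t))\<^sup>2)"
    by eventually_elim (auto simp: indicator_def)
  then have "L2sq T w = L2sq T v"
    unfolding L2sq_def by (rule nn_integral_cong_AE)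
  then show ?thesis
    unfolding H1norm_def w_def by simp
qed

lemma H1norm_le:
  fixes u :: "real \<Rightarrow> 'a::banach"
  assumes T: "T > 0" and u: "H1_deriv T u v" and M: "M \<ge> 0"
    and bounds: "\<And>t. t \<in> {0..T} \<Longrightarrow> norm (u t) \<le> M" "\<And>t. t \<in> {0..T} \<Longrightarrow> norm (v t) \<le> M"
  shows "H1norm T u \<le> sqrt (2 * T) * M"
proof -
  have "enn2real (L2sq T u) \<le> T * M\<^sup>2" "enn2real (L2sq T v) \<le> T * M\<^sup>2"
    using L2sq_le[of T u M] L2sq_le[of T v M] T bounds by (auto intro!: enn2real_leI)
  then have "H1norm T u \<le> sqrt (2 * T * M\<^sup>2)"
    unfolding H1norm_eq[OF T u] by (intro real_sqrt_le_mono) simp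
  also have "\<dots> = sqrt (2 * T) * M"
    using M by (simp add: real_sqrt_mult)
  finally show ?thesis .
qed

text \<open>Compare the value at s with the value at t and average over t. Young's inequality with
  weight a, for any a above the norm, trades integrals of norms for integrals of squares. Each costs
  at most a/2 * T + a/2 = a * (T + 1)/2, which is the origin of the constant.\<close>

lemma H1_sup_bound:
  fixes h :: "real \<Rightarrow> 'a::banach"
  assumes T: "T > 0" and h: "h \<in> H1 T" and s: "s \<in> {0..T}"
  shows "norm (h s) \<le> (T + 1) * (1/2 + T) / T * H1norm T h"
proof -
  obtain v where v: "H1_deriv T h v"
    using h by (auto simp: H1_def)
  define N where "N = H1norm T h"
  define C where "C = (T + 1) * (1/2 + T) / T"
  have C: "C > 0" using T by (simp add: C_def add_pos_pos)
  have cont: "continuous_on {0..T} h"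
    using T h by (intro H1_continuous_on) auto
  have "compact (h ` {0..T})"
    using cont by (rule compact_continuous_image) auto
  then obtain M where "\<And>t. t \<in> {0..T} \<Longrightarrow> norm (h t) \<le> M"
    using compact_imp_bounded by (force simp: bounded_iff)
  then have "L2sq T h \<le> ennreal (T * M\<^sup>2)"
    using T by (intro L2sq_le) auto
  then have "L2sq T h < \<infinity>"
    using le_less_trans ennreal_less_top by (metis infinity_ennreal_def)
  then have int_h: "((\<lambda>t. (norm (h t))\<^sup>2) has_integral enn2real (L2sq T h)) {0..T}"
    by (intro L2sq_has_integral strongly_measurable_on_continuous[OF T cont])
  have int_v: "((\<lambda>t. (norm (v t))\<^sup>2) has_integral enn2real (L2sq T v)) {0..T}"
    using v by (intro L2sq_has_integral) (auto simp: H1_deriv_def)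
  have N_eq: "N\<^sup>2 = enn2real (L2sq T h) + enn2real (L2sq T v)"
    unfolding N_def H1norm_eq[OF T v] by simp
  \<comment> \<open>Strictness keeps a positive even when the norm is 0; a is sent down to
    \<open>N\<close> at the end.\<close>
  have key: "norm (h s) \<le> C * a" if a: "a > N" for a
  proof -
    have "N \<ge> 0" by (simp add: N_def H1norm_nonneg)
    then have "a > 0" "N\<^sup>2 \<le> a\<^sup>2" using a by (auto intro: power_mono)
    then have L2_le: "enn2real (L2sq T h) \<le> a\<^sup>2" "enn2real (L2sq T v) \<le> a\<^sup>2"
      using enn2real_nonneg[of "L2sq T h"] enn2real_nonneg[of "L2sq T v"] unfolding N_eq by linarith+
    have young: "x \<le> a / 2 + x\<^sup>2 / (2 * a)" for x :: real
    proof -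
      have "0 \<le> (a - x)\<^sup>2" by simp
      then have "2 * a * x \<le> a\<^sup>2 + x\<^sup>2" by (simp add: power2_eq_square algebra_simps)
      then show ?thesis using \<open>a > 0\<close> by (simp add: field_simps power2_eq_square)
    qed
    define G where "G w t = a / 2 + (norm (w t :: 'a))\<^sup>2 / (2 * a)" for w and t :: real
    define J where "J w = a / 2 * T + enn2real (L2sq T w) / (2 * a)" for w :: "real \<Rightarrow> 'a"
    have G_int: "(G w has_integral J w) {0..T}"
      if "((\<lambda>t. (norm (w t))\<^sup>2) has_integral enn2real (L2sq T w)) {0..T}" for w
      unfolding G_def J_def
      using has_integral_add[OF has_integral_const_real[of "a / 2" 0 T]
          has_integral_divide[OF that, of "2 * a"]] T
      by (simp add: mult.commute)
    have J_le: "J w \<le> a * (T + 1) / 2" if "enn2real (L2sq T w) \<le> a\<^sup>2" for w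
      using that \<open>a > 0\<close> by (simp add: J_def field_simps power2_eq_square)
    have incr: "norm (h t - h 0) \<le> J v" if t: "t \<in> {0..T}" for t
    proof -
      have sub: "G v integrable_on {0..t}"
        using t by (intro integrable_on_subinterval[OF has_integral_integrable[OF G_int[OF int_v]]]) auto
      have "norm (h t - h 0) = norm (integral {0..t} v)"
        using H1_derivD[OF v t] by (simp add: integral_unique)
      also have "\<dots> \<le> integral {0..t} (G v)"
        using H1_derivD[OF v t] sub young
        by (intro Henstock_Kurzweil_Integration.integral_norm_bound_integral) (auto simp: G_def)
      also have "\<dots> \<le> integral {0..T} (G v)"
        using t sub has_integral_integrable[OF G_int[OF int_v]] \<open>a > 0\<close>
        by (intro integral_subset_le) (auto simp: G_def)
      also have "\<dots> = J v"
        using G_int[OF int_v] by (rule integral_unique)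
      finally show ?thesis .
    qed
    \<comment> \<open>Going from s to t through 0 uses two increments, at
      \<open>a * (T + 1) / 2\<close> each.\<close>
    have pointwise: "norm (h s) - a * (T + 1) \<le> G h t" if t: "t \<in> {0..T}" for t
    proof -
      have "norm (h s) \<le> norm (h t) + (norm (h s - h 0) + norm (h t - h 0))"
        using norm_triangle_ineq4[of "h s - h 0" "h t - h 0"] norm_triangle_ineq2[of "h s" "h t"] by simp
      also have "\<dots> \<le> norm (h t) + a * (T + 1)"
        using incr[OF s] incr[OF t] J_le[OF L2_le(2)] by simp
      finally show ?thesis
        using young[of "norm (h t)"] by (simp add: G_def)
    qed
    have "((\<lambda>t. norm (h s) - a * (T + 1)) has_integral (T * (norm (h s) - a * (T + 1)))) {0..T}"
      using has_integral_const_real[of "norm (h s) - a * (T + 1)" 0 T] T by simp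
    then have "T * (norm (h s) - a * (T + 1)) \<le> J h"
      using G_int[OF int_h] pointwise by (rule has_integral_le)
    also have "\<dots> \<le> a * (T + 1) / 2"
      by (rule J_le[OF L2_le(1)])
    finally show ?thesis
      using T by (simp add: C_def field_simps)
  qed
  show ?thesis
  proof (rule ccontr)
    assume "\<not> norm (h s) \<le> (T + 1) * (1/2 + T) / T * H1norm T h"
    then have "C * N < norm (h s)" by (simp add: C_def N_def)
    then have "N < norm (h s) / C"
      using C by (simp add: field_simps)
    then obtain a where "N < a" "a < norm (h s) / C"
      using dense by blast
    then show False
      using key[of a] C by (simp add: field_simps)
  qed
qed

section \<open>Ordinary differential equations in Banach spaces\<close>

text \<open>Nothing outside \<open>{0..T}\<close> enters \<open>H1_deriv\<close>, so solutions may
  be cut off there and right-hand sides rewritten only where an identity is known.\<close>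

lemma H1_deriv_cong:
  assumes T: "T \<ge> 0" and u: "\<And>t. t \<in> {0..T} \<Longrightarrow> u t = u' t" and v: "\<And>t. t \<in> {0..T} \<Longrightarrow> v t = v' t"
  shows "H1_deriv T u v \<longleftrightarrow> H1_deriv T u' v'"
proof -
  have "L2sq T v = L2sq T v'"
    unfolding L2sq_def using v by (intro nn_integral_cong) (auto simp: indicator_def)
  moreover have "(v has_integral (u t - u 0)) {0..t} \<longleftrightarrow> (v' has_integral (u' t - u' 0)) {0..t}"
    if "t \<in> {0..T}" for t
    using that u[OF that] u[of 0] T by (auto intro!: has_integral_cong v)
  moreover have "strongly_measurable_on {0..T} v \<longleftrightarrow> strongly_measurable_on {0..T} v'"
    unfolding strongly_measurable_on_def using v by (simp cong: imp_cong)
  ultimately show ?thesis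
    by (simp add: H1_deriv_def)
qed

text \<open>Serves a solution and its derivative at once. With k = K + 1 and E = 2 * T * exp (2 * k
  * T) * M, the solution is bounded by E and the derivative by k * E + M; k at least 1 makes the
  second bound cover the first.\<close>

definition gronwall_const :: "real \<Rightarrow> real \<Rightarrow> real" where
  "gronwall_const T K = 1 + (K + 1) * (2 * T * exp (2 * (K + 1) * T))"

lemma gronwall_const_nonneg: "T \<ge> 0 \<Longrightarrow> K \<ge> 0 \<Longrightarrow> gronwall_const T K \<ge> 0"
  by (simp add: gronwall_const_def)

text \<open>Rate 2 * k against the factor k leaves 1/2. This half is the absorbed fraction in
  \<open>gronwall\<close> and the contraction constant in \<open>ode_exists\<close>.\<close>

lemma has_integral_exp_weight:
  fixes k S t :: real
  assumes "t \<ge> 0"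
  shows "((\<lambda>s. k * (exp (2 * k * s) * S)) has_integral S * (exp (2 * k * t) - 1) / 2) {0..t}"
proof -
  have "((\<lambda>s. S * exp (2 * k * s) / 2) has_vector_derivative k * (exp (2 * k * s) * S)) (at s within {0..t})" for s
    unfolding has_real_derivative_iff_has_vector_derivative[symmetric]
    by (auto intro!: derivative_eq_intros)
  from fundamental_theorem_of_calculus[OF assms this] show ?thesis
    by (simp add: algebra_simps diff_divide_distrib)
qed

text \<open>The supremum of the weighted norm is absorbed into the left-hand side.\<close>

lemma gronwall:
  fixes u :: "real \<Rightarrow> 'a::banach"
  assumes T: "T > 0" and K: "K \<ge> 0" and M: "M \<ge> 0"
    and u: "H1_deriv T u v" and u0: "u 0 = 0"
    and v: "\<And>t. t \<in> {0..T} \<Longrightarrow> norm (v t) \<le> K * norm (u t) + M"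
    and t: "t \<in> {0..T}"
  shows "norm (u t) \<le> gronwall_const T K * M" "norm (v t) \<le> gronwall_const T K * M"
proof -
  define k where "k = K + 1"
  have k: "k > 0" "k \<ge> 1" "K \<le> k" using K by (auto simp: k_def)
  have cont: "continuous_on {0..T} u"
    using H1_deriv_continuous_on[OF _ u] T by simp
  have "continuous_on {0..T} (\<lambda>t. exp (- 2 * k * t) * norm (u t))"
    by (intro continuous_intros cont)
  then obtain r where r: "r \<in> {0..T}"
      "\<And>t. t \<in> {0..T} \<Longrightarrow> exp (- 2 * k * t) * norm (u t) \<le> exp (- 2 * k * r) * norm (u r)"
    using continuous_attains_sup[of "{0..T}" "\<lambda>t. exp (- 2 * k * t) * norm (u t)"] T by auto
  define S where "S = exp (- 2 * k * r) * norm (u r)"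
  have S: "S \<ge> 0" by (simp add: S_def)
  have u_le: "norm (u t) \<le> exp (2 * k * t) * S" if "t \<in> {0..T}" for t
    using r(2)[OF that] unfolding S_def[symmetric] by (simp add: exp_minus field_simps)
  have u_r: "norm (u r) = exp (2 * k * r) * S"
    by (simp add: S_def exp_minus field_simps)
  have int: "((\<lambda>s. k * (exp (2 * k * s) * S) + M) has_integral S * (exp (2 * k * r) - 1) / 2 + M * r) {0..r}"
    using has_integral_add[OF has_integral_exp_weight[of r k S] has_integral_const_real[of M 0 r]] r(1)
    by (simp add: mult.commute)
  have "norm (u r) = norm (integral {0..r} v)"
    using H1_derivD[OF u r(1)] u0 by (simp add: integral_unique)
  also have "\<dots> \<le> integral {0..r} (\<lambda>s. k * (exp (2 * k * s) * S) + M)"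
  proof (rule Henstock_Kurzweil_Integration.integral_norm_bound_integral)
    show "v integrable_on {0..r}" using H1_derivD[OF u r(1)] by auto
    show "(\<lambda>s. k * (exp (2 * k * s) * S) + M) integrable_on {0..r}" using int by auto
    fix s assume "s \<in> {0..r}"
    then have s: "s \<in> {0..T}" using r(1) by auto
    have "norm (v s) \<le> K * norm (u s) + M" by (rule v[OF s])
    also have "K * norm (u s) \<le> k * (exp (2 * k * s) * S)"
      using k u_le[OF s] by (intro mult_mono) auto
    finally show "norm (v s) \<le> k * (exp (2 * k * s) * S) + M" by simp
  qed
  also have "\<dots> = S * (exp (2 * k * r) - 1) / 2 + M * r"
    using int by (rule integral_unique)
  \<comment> \<open>The chain started from \<open>norm (u r)\<close>, which is
    \<open>S * exp (2 * k * r)\<close>, so half of it can be subtracted on both sides.\<close>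
  also have "\<dots> \<le> S * exp (2 * k * r) / 2 + M * T"
    using S M r(1) by (intro add_mono mult_left_mono divide_right_mono) auto
  finally have "S * exp (2 * k * r) \<le> 2 * M * T"
    unfolding u_r by (simp add: mult.commute mult.left_commute)
  moreover have "S * 1 \<le> S * exp (2 * k * r)"
    using S k r(1) by (intro mult_left_mono) auto
  ultimately have S_le: "S \<le> 2 * M * T" by simp
  have main: "norm (u t) \<le> exp (2 * k * T) * (2 * M * T)"
  proof -
    have "norm (u t) \<le> exp (2 * k * t) * S" by (rule u_le[OF t])
    also have "\<dots> \<le> exp (2 * k * T) * (2 * M * T)"
      using S S_le t k M T by (intro mult_mono) auto
    finally show ?thesis .
  qed
  define E where "E = exp (2 * k * T) * (2 * M * T)"
  have E: "E \<ge> 0" using M T by (simp add: E_def)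
  have const: "gronwall_const T K * M = M + k * E"
    by (simp add: gronwall_const_def E_def k_def algebra_simps)
  have "E \<le> k * E" using E k by (simp add: mult_le_cancel_right1)
  then show "norm (u t) \<le> gronwall_const T K * M"
    using main M unfolding const E_def[symmetric] by linarith
  have "norm (v t) \<le> K * norm (u t) + M" by (rule v[OF t])
  also have "K * norm (u t) \<le> k * E"
    using k K main by (intro mult_mono) (auto simp: E_def)
  finally show "norm (v t) \<le> gronwall_const T K * M"
    unfolding const by simp
qed

lemma gronwall_H1norm:
  fixes u :: "real \<Rightarrow> 'a::banach"
  assumes "T > 0" "K \<ge> 0" "M \<ge> 0" "H1_deriv T u v" "u 0 = 0"
    and "\<And>t. t \<in> {0..T} \<Longrightarrow> norm (v t) \<le> K * norm (u t) + M"
  shows "H1norm T u \<le> sqrt (2 * T) * gronwall_const T K * M"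
  using H1norm_le[OF assms(1,4) _ gronwall[OF assms(1-5)]] gronwall_const_nonneg[of T K] assms
  by (simp add: mult.assoc)

section \<open>Well-posedness for Lipschitz right-hand sides\<close>

lemma ode_unique:
  fixes u w :: "real \<Rightarrow> 'a::banach"
  assumes T: "T > 0" and K: "K \<ge> 0"
    and lip: "\<And>t x y. t \<in> {0..T} \<Longrightarrow> norm (f t x - f t y) \<le> K * norm (x - y)"
    and u: "H1_deriv T u (\<lambda>t. f t (u t))" and w: "H1_deriv T w (\<lambda>t. f t (w t))" and "u 0 = w 0"
    and t: "t \<in> {0..T}"
  shows "u t = w t"
proof -
  have "norm (u t - w t) \<le> gronwall_const T K * 0"
    by (rule gronwall(1)[OF T K _ H1_deriv_diff[OF u w] _ _ t]) (auto simp: assms lip)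
  then show ?thesis by simp
qed

text \<open>Picard iteration in Bielecki's weighted norm, which contracts on the whole interval
  whatever T is. The weight is put into the unknown, x t = exp (- 2 * k * t) * u t, so that the
  supremum metric of bounded continuous functions can be used.\<close>

lemma ode_exists:
  fixes f :: "real \<Rightarrow> 'a::banach \<Rightarrow> 'a"
  assumes T: "T > 0" and K: "K \<ge> 0"
    and lip: "\<And>t x y. t \<in> {0..T} \<Longrightarrow> norm (f t x - f t y) \<le> K * norm (x - y)"
    and cont: "\<And>x. continuous_on {0..T} x \<Longrightarrow> continuous_on {0..T} (\<lambda>t. f t (x t))"
  shows "\<exists>u. u 0 = x0 \<and> H1_deriv T u (\<lambda>t. f t (u t))"
proof -
  define k where "k = K + 1"
  have k: "k > 0" "K \<le> k" using K by (auto simp: k_def)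
  \<comment> \<open>Clamping time to \<open>{0..T}\<close> extends the iterates to bounded
    continuous functions on the line, a complete space.\<close>
  define p where "p t = max 0 (min T t)" for t :: real
  have p: "p t \<in> {0..T}" for t using T by (auto simp: p_def)
  have p_id: "p t = t" if "t \<in> {0..T}" for t using that by (auto simp: p_def)
  define g where "g x s = f s (exp (2 * k * s) *\<^sub>R apply_bcontfun x s)" for x s
  have g: "continuous_on {0..T} (g x)" for x
    unfolding g_def by (intro cont continuous_intros continuous_on_apply_bcontfun)
  have g_int: "g x integrable_on {0..t}" if "t \<in> {0..T}" for x t
    using that by (intro integrable_continuous_real continuous_on_subset[OF g]) auto
  define F where "F x t = exp (- 2 * k * t) *\<^sub>R (x0 + integral {0..t} (g x))" for x t
  have F: "continuous_on {0..T} (F x)" for x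
    unfolding F_def using g_int[of T x] T
    by (intro continuous_intros indefinite_integral_continuous_1) auto
  have Fp: "(\<lambda>t. F x (p t)) \<in> bcontfun" for x
  proof -
    have "compact (F x ` {0..T})"
      using F by (rule compact_continuous_image) auto
    then obtain B where "\<And>t. t \<in> {0..T} \<Longrightarrow> norm (F x t) \<le> B"
      using compact_imp_bounded by (force simp: bounded_iff)
    moreover have "continuous_on UNIV (\<lambda>t. F x (p t))"
      by (rule continuous_on_compose2[OF F]) (use p in \<open>auto simp: p_def intro!: continuous_intros\<close>)
    ultimately show ?thesis
      using p by (intro bcontfun_normI) auto
  qed
  define \<Phi> where "\<Phi> x = Bcontfun (\<lambda>t. F x (p t))" for x
  have \<Phi>: "apply_bcontfun (\<Phi> x) t = F x (p t)" for x t
    unfolding \<Phi>_def using Bcontfun_inverse[OF Fp] by simp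
  have "dist (\<Phi> x) (\<Phi> y) \<le> 1/2 * dist x y" for x y
  proof (rule dist_bound)
    fix t
    let ?r = "p t" and ?S = "dist x y"
    have "dist (\<Phi> x t) (\<Phi> y t) = norm (exp (- 2 * k * ?r) *\<^sub>R integral {0..?r} (\<lambda>s. g x s - g y s))"
      using g_int[OF p] by (simp add: \<Phi> dist_norm F_def Henstock_Kurzweil_Integration.integral_diff scaleR_diff_right[symmetric])
    also have "\<dots> = exp (- 2 * k * ?r) * norm (integral {0..?r} (\<lambda>s. g x s - g y s))"
      by simp
    also have "norm (integral {0..?r} (\<lambda>s. g x s - g y s)) \<le> integral {0..?r} (\<lambda>s. k * (exp (2 * k * s) * ?S))"
    proof (rule Henstock_Kurzweil_Integration.integral_norm_bound_integral)
      show "(\<lambda>s. g x s - g y s) integrable_on {0..?r}"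
        using g_int[OF p] by (intro integrable_diff)
      show "(\<lambda>s. k * (exp (2 * k * s) * ?S)) integrable_on {0..?r}"
        using has_integral_exp_weight[of ?r] p[of t] by auto
      fix s assume "s \<in> {0..?r}"
      then have s: "s \<in> {0..T}" using p[of t] by auto
      have "norm (g x s - g y s) \<le> K * norm (exp (2 * k * s) *\<^sub>R x s - exp (2 * k * s) *\<^sub>R y s)"
        unfolding g_def by (rule lip[OF s])
      also have "\<dots> = K * (exp (2 * k * s) * dist (x s) (y s))"
        by (simp add: scaleR_diff_right[symmetric] dist_norm)
      also have "\<dots> \<le> k * (exp (2 * k * s) * ?S)"
        using k K by (intro mult_mono dist_bounded) auto
      finally show "norm (g x s - g y s) \<le> k * (exp (2 * k * s) * ?S)" .
    qed
    also have "\<dots> = ?S * (exp (2 * k * ?r) - 1) / 2"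
      using has_integral_exp_weight[of ?r] p[of t] by (intro integral_unique) auto
    \<comment> \<open>The outer weight cancels the exponential growth and leaves a factor at most
      1/2 for every t.\<close>
    also have "exp (- 2 * k * ?r) * (?S * (exp (2 * k * ?r) - 1) / 2) = ?S * (1 - exp (- 2 * k * ?r)) / 2"
      by (simp add: exp_minus field_simps)
    also have "\<dots> \<le> ?S * 1 / 2"
      by (intro divide_right_mono mult_left_mono) auto
    finally show "dist (\<Phi> x t) (\<Phi> y t) \<le> 1/2 * ?S"
      by simp
  qed
  then have "\<exists>!x. \<Phi> x = x"
    by (intro banach_fix_type[of "1/2"]) auto
  then obtain x where x: "\<Phi> x = x" by blast
  define u where "u t = exp (2 * k * t) *\<^sub>R apply_bcontfun x t" for t
  have u_eq: "u t = x0 + integral {0..t} (g x)" if "t \<in> {0..T}" for t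
  proof -
    have "apply_bcontfun x t = F x t"
      using \<Phi>[of x t] p_id[OF that] x by simp
    then show ?thesis
      by (simp add: u_def F_def exp_minus)
  qed
  have u0: "u 0 = x0" using u_eq[of 0] T by simp
  have g_u: "g x = (\<lambda>t. f t (u t))" by (rule ext) (simp add: g_def u_def)
  have "H1_deriv T u (\<lambda>t. f t (u t))"
  proof (rule H1_derivI[OF T])
    show "continuous_on {0..T} (\<lambda>t. f t (u t))"
      using g[of x] by (simp add: g_u)
    fix t assume t: "t \<in> {0..T}"
    show "((\<lambda>t. f t (u t)) has_integral u t - u 0) {0..t}"
      using integrable_integral[OF g_int[OF t, of x]] u_eq[OF t] u0 by (simp add: g_u)
  qed
  with u0 show ?thesis by blast
qed

section \<open>Bounded linear maps and continuity near compact sets\<close>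

lemma blinfun_apply_bound:
  "norm f \<le> a \<Longrightarrow> norm x \<le> b \<Longrightarrow> norm (blinfun_apply f x) \<le> a * b"
  by (rule order_trans[OF norm_blinfun]) (auto intro!: mult_mono intro: order_trans[OF norm_ge_zero])

lemma H1_deriv_blinfun:
  fixes u :: "real \<Rightarrow> 'a::banach" and L :: "'a \<Rightarrow>\<^sub>L 'b::banach"
  assumes "T > 0" "H1_deriv T u v" "continuous_on {0..T} v"
  shows "H1_deriv T (\<lambda>t. L (u t)) (\<lambda>t. L (v t))"
proof (rule H1_derivI)
  show "continuous_on {0..T} (\<lambda>t. L (v t))"
    using assms(3) by (intro continuous_intros)
  fix t assume "t \<in> {0..T}"
  from has_integral_linear[OF H1_derivD[OF assms(2) this] blinfun.bounded_linear_right[of L]]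
  show "((\<lambda>t. L (v t)) has_integral L (u t) - L (u 0)) {0..t}"
    by (simp add: o_def blinfun.diff_right)
qed fact

text \<open>Only x is confined to S: perturbed arguments leave the orbit, and in infinite dimension
  an orbit has no compact neighbourhood on which uniform continuity could be invoked. A Lebesgue
  number of the cover by preimages of small balls replaces it.\<close>

lemma continuous_near_compact:
  fixes f :: "'a::metric_space \<Rightarrow> 'b::metric_space"
  assumes f: "continuous_on UNIV f" and S: "compact S" and e: "e > 0"
  obtains d where "d > 0" "\<And>x y. x \<in> S \<Longrightarrow> dist x y < d \<Longrightarrow> dist (f x) (f y) < e"
proof -
  let ?G = "range (\<lambda>c. f -` ball (f c) (e / 2))"
  have op: "open G" if "G \<in> ?G" for G
    using that f by (auto intro!: open_vimage)
  have "x \<in> \<Union>?G" for x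
    using e by (auto intro!: exI[of _ x])
  then have "S \<subseteq> \<Union>?G" by blast
  then obtain d where d: "d > 0" "\<And>x. x \<in> S \<Longrightarrow> \<exists>G\<in>?G. ball x d \<subseteq> G"
    using Heine_Borel_lemma[OF S _ op] by metis
  have "dist (f x) (f y) < e" if xy: "x \<in> S" "dist x y < d" for x y
  proof -
    obtain c where c: "ball x d \<subseteq> f -` ball (f c) (e / 2)"
      using d(2)[OF xy(1)] by auto
    have "x \<in> ball x d" "y \<in> ball x d" using d(1) xy(2) by auto
    then have "f x \<in> ball (f c) (e / 2)" "f y \<in> ball (f c) (e / 2)" using c by blast+
    then have "dist (f c) (f x) < e / 2" "dist (f c) (f y) < e / 2" by simp_all
    then show ?thesis
      using dist_triangle3[of "f x" "f y" "f c"] by simp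
  qed
  with d(1) show ?thesis by (rule that)
qed

section \<open>The state equation and its linearisations\<close>

text \<open>A single constant bounds all the data; \<open>e\<close> is the embedding of Z into W, and the
  intermediate space H plays no role in the estimates.\<close>

locale evolution =
  fixes T C :: real
    and eYZ :: "'y::banach \<Rightarrow>\<^sub>L 'z::banach"
    and e :: "'z \<Rightarrow>\<^sub>L 'w::banach"
    and R :: "'x::banach \<Rightarrow>\<^sub>L 'y"
    and Q :: "'w \<Rightarrow>\<^sub>L 'w" and QZ :: "'z \<Rightarrow>\<^sub>L 'z" and QY :: "'y \<Rightarrow>\<^sub>L 'y"
    and A :: "'y \<Rightarrow> 'y"
    and A1 :: "'y \<Rightarrow> ('z \<Rightarrow>\<^sub>L 'z)" and A1W :: "'y \<Rightarrow> ('w \<Rightarrow>\<^sub>L 'w)"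
    and A2 :: "'y \<Rightarrow> ('z \<Rightarrow>\<^sub>L ('z \<Rightarrow>\<^sub>L 'w))"
    and z0 :: 'y
  assumes T_pos: "T > 0"
    and C_ge1: "C \<ge> 1"
    and e_QZ: "\<And>z. e (QZ z) = Q (e z)"
    and eYZ_QY: "\<And>y. eYZ (QY y) = QZ (eYZ y)"
    and A1W_e: "\<And>y z. A1W y (e z) = e (A1 y z)"
    and A_deriv: "\<And>y. ((\<lambda>y. eYZ (A y)) has_derivative (\<lambda>k. A1 y (eYZ k))) (at y)"
    and A1_deriv: "\<And>y. ((\<lambda>y. e o\<^sub>L A1 y) has_derivative (\<lambda>k. A2 y (eYZ k))) (at y)"
    and A2_cont: "continuous_on UNIV A2"
    and A_lip: "\<And>y1 y2. norm (A y1 - A y2) \<le> C * norm (y1 - y2)"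
    and A1_lip: "\<And>y1 y2. norm (A1 y1 - A1 y2) \<le> C * norm (y1 - y2)"
    and A1W_lip: "\<And>y1 y2. norm (A1W y1 - A1W y2) \<le> C * norm (y1 - y2)"
    and bounds: "norm R \<le> C" "norm eYZ \<le> C" "norm e \<le> C" "norm Q \<le> C" "norm QZ \<le> C" "norm QY \<le> C"
      "\<And>y. norm (A1 y) \<le> C" "\<And>y. norm (A1W y) \<le> C" "\<And>y. norm (A2 y) \<le> C"
begin

lemma C_pos: "C > 0" "C \<ge> 0" "C * C \<ge> 0" and T_nonneg: "T \<ge> 0"
  using C_ge1 T_pos by auto

lemma apply_le:
  "norm (R x) \<le> C * norm x" "norm (eYZ y) \<le> C * norm y" "norm (e z) \<le> C * norm z"
  "norm (Q w) \<le> C * norm w" "norm (QZ z) \<le> C * norm z" "norm (QY y) \<le> C * norm y"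
  "norm (A1 y z) \<le> C * norm z" "norm (A1W y w) \<le> C * norm w"
  by (rule blinfun_apply_bound[OF bounds(1) order_refl] blinfun_apply_bound[OF bounds(2) order_refl]
    blinfun_apply_bound[OF bounds(3) order_refl] blinfun_apply_bound[OF bounds(4) order_refl]
    blinfun_apply_bound[OF bounds(5) order_refl] blinfun_apply_bound[OF bounds(6) order_refl]
    blinfun_apply_bound[OF bounds(7) order_refl] blinfun_apply_bound[OF bounds(8) order_refl])+

lemma lipschitz_continuous:
  fixes f :: "'a::real_normed_vector \<Rightarrow> 'b::real_normed_vector"
  assumes "\<And>y1 y2. norm (f y1 - f y2) \<le> C * norm (y1 - y2)"
  shows "continuous_on UNIV f"
  using lipschitz_on_continuous_on[of C UNIV f] assms C_pos
  by (auto simp: lipschitz_on_def dist_norm)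

lemma continuous_on_compositions [continuous_intros]:
  assumes "continuous_on S u"
  shows "continuous_on S (\<lambda>t::real. A (u t))" "continuous_on S (\<lambda>t. A1 (u t))"
    "continuous_on S (\<lambda>t. A1W (u t))" "continuous_on S (\<lambda>t. A2 (u t))"
  using assms lipschitz_continuous[OF A_lip] lipschitz_continuous[OF A1_lip]
    lipschitz_continuous[OF A1W_lip] A2_cont
  by (auto intro: continuous_on_compose2)

abbreviation z :: "(real \<Rightarrow> 'x) \<Rightarrow> real \<Rightarrow> 'y" where
  "z \<equiv> sol_op T A R QY z0"

definition y :: "(real \<Rightarrow> 'x) \<Rightarrow> real \<Rightarrow> 'y" where
  "y l t = R (l t) - QY (z l t)"

definition eta_sol :: "(real \<Rightarrow> 'x) \<Rightarrow> (real \<Rightarrow> 'x) \<Rightarrow> (real \<Rightarrow> 'z) \<Rightarrow> bool" where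
  "eta_sol l h \<eta> \<longleftrightarrow> \<eta> 0 = 0 \<and> H1_deriv T \<eta> (\<lambda>t. A1 (y l t) (eYZ (R (h t)) - QZ (\<eta> t)))"

text \<open>The choice is immaterial on \<open>{0..T}\<close> by \<open>eta_unique\<close>; outside
  it is arbitrary, so linearity is claimed on \<open>{0..T}\<close> only.\<close>

definition eta :: "(real \<Rightarrow> 'x) \<Rightarrow> (real \<Rightarrow> 'x) \<Rightarrow> real \<Rightarrow> 'z" where
  "eta l h = (SOME \<eta>. eta_sol l h \<eta>)"

text \<open>Derivative of \<open>y\<close> at l in the direction h, as an element of Z.\<close>

definition p :: "(real \<Rightarrow> 'x) \<Rightarrow> (real \<Rightarrow> 'x) \<Rightarrow> real \<Rightarrow> 'z" where
  "p l h t = eYZ (R (h t)) - QZ (eta l h t)"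

definition xi_sol :: "(real \<Rightarrow> 'x) \<Rightarrow> (real \<Rightarrow> 'x) \<Rightarrow> (real \<Rightarrow> 'x) \<Rightarrow> (real \<Rightarrow> 'w) \<Rightarrow> bool" where
  "xi_sol l h k \<xi> \<longleftrightarrow>
    \<xi> 0 = 0 \<and> H1_deriv T \<xi> (\<lambda>t. A2 (y l t) (p l h t) (p l k t) - A1W (y l t) (Q (\<xi> t)))"

definition xi :: "(real \<Rightarrow> 'x) \<Rightarrow> (real \<Rightarrow> 'x) \<Rightarrow> (real \<Rightarrow> 'x) \<Rightarrow> real \<Rightarrow> 'w" where
  "xi l h k = (SOME \<xi>. xi_sol l h k \<xi>)"

section \<open>Well-posedness of the state equation and of both linearised equations\<close>

lemma state_lip: "norm (A (r - QY x) - A (r - QY x')) \<le> (C * C) * norm (x - x')"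
proof -
  have "norm (A (r - QY x) - A (r - QY x')) \<le> C * norm (QY (x' - x))"
    using A_lip[of "r - QY x" "r - QY x'"] by (simp add: blinfun.diff_right)
  also have "\<dots> \<le> C * (C * norm (x' - x))"
    using C_pos by (intro mult_left_mono apply_le)
  finally show ?thesis by (simp add: norm_minus_commute)
qed

lemma eta_lip: "norm (A1 v (r - QZ x) - A1 v (r - QZ x')) \<le> (C * C) * norm (x - x')"
proof -
  have "norm (A1 v (r - QZ x) - A1 v (r - QZ x')) = norm (A1 v (QZ (x' - x)))"
    by (simp add: blinfun.diff_right)
  also have "\<dots> \<le> C * (C * norm (x' - x))"
    by (intro order_trans[OF apply_le(7)] mult_left_mono apply_le C_pos)
  finally show ?thesis by (simp add: norm_minus_commute)
qed

text \<open>In the difference of two right-hand sides the inhomogeneity cancels and the feedback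
  carries a minus sign, hence the swapped arguments.\<close>

lemma xi_lip: "norm (A1W v (Q x') - A1W v (Q x)) \<le> (C * C) * norm (x - x')"
proof -
  have "norm (A1W v (Q x') - A1W v (Q x)) = norm (A1W v (Q (x' - x)))"
    by (simp add: blinfun.diff_right)
  also have "\<dots> \<le> C * (C * norm (x' - x))"
    by (intro order_trans[OF apply_le(8)] mult_left_mono apply_le C_pos)
  finally show ?thesis by (simp add: norm_minus_commute)
qed

lemma z_sol:
  assumes l: "l \<in> H1 T"
  shows "z l 0 = z0" "H1_deriv T (z l) (\<lambda>t. A (y l t))"
proof -
  let ?P = "\<lambda>z. z 0 = z0 \<and> H1_deriv T z (\<lambda>t. A (R (l t) - QY (z t))) \<and> (\<forall>t. t \<notin> {0..T} \<longrightarrow> z t = 0)"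
  have l_cont: "continuous_on {0..T} l"
    by (rule H1_continuous_on[OF T_nonneg l])
  have "\<exists>u. u 0 = z0 \<and> H1_deriv T u (\<lambda>t. A (R (l t) - QY (u t)))"
    by (rule ode_exists[OF T_pos C_pos(3), of "\<lambda>t x. A (R (l t) - QY x)"])
      (auto intro!: state_lip continuous_intros l_cont)
  then obtain u where u: "u 0 = z0" "H1_deriv T u (\<lambda>t. A (R (l t) - QY (u t)))" by blast
  \<comment> \<open>\<open>sol_op\<close> prescribes 0 outside \<open>{0..T}\<close>; this turns
    uniqueness on the interval into uniqueness of the function, as THE requires.\<close>
  define v where "v t = (if t \<in> {0..T} then u t else 0)" for t
  have "H1_deriv T v (\<lambda>t. A (R (l t) - QY (v t)))"
    using u(2) by (subst H1_deriv_cong[OF T_nonneg]) (auto simp: v_def)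
  then have v: "?P v" using u(1) T_nonneg by (auto simp: v_def)
  have "w = v" if w: "?P w" for w
  proof
    fix t show "w t = v t"
    proof (cases "t \<in> {0..T}")
      case True
      show ?thesis
        by (rule ode_unique[OF T_pos C_pos(3), of "\<lambda>t x. A (R (l t) - QY x)"])
          (use v w True in \<open>auto intro: state_lip\<close>)
    qed (use v w in auto)
  qed
  then have "?P (z l)"
    unfolding sol_op_def using v by (intro theI[where P="?P"])
  then show "z l 0 = z0" "H1_deriv T (z l) (\<lambda>t. A (y l t))"
    by (auto simp: y_def)
qed

lemma z_cont: "l \<in> H1 T \<Longrightarrow> continuous_on {0..T} (z l)"
  by (rule H1_deriv_continuous_on[OF T_nonneg z_sol(2)])

lemma y_cont [continuous_intros]: "l \<in> H1 T \<Longrightarrow> continuous_on {0..T} (y l)"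
  unfolding y_def by (intro continuous_intros z_cont H1_continuous_on T_nonneg)

lemma eta_sol_eta:
  assumes l: "l \<in> H1 T" and h: "h \<in> H1 T"
  shows "eta_sol l h (eta l h)"
proof -
  have "\<exists>\<eta>. \<eta> 0 = 0 \<and> H1_deriv T \<eta> (\<lambda>t. A1 (y l t) (eYZ (R (h t)) - QZ (\<eta> t)))"
    by (rule ode_exists[OF T_pos C_pos(3), of "\<lambda>t x. A1 (y l t) (eYZ (R (h t)) - QZ x)"])
      (auto intro!: eta_lip continuous_intros l H1_continuous_on[OF T_nonneg h])
  then show ?thesis
    unfolding eta_def eta_sol_def by (rule someI_ex)
qed

lemma eta_unique:
  assumes "eta_sol l h \<eta>" "eta_sol l h \<eta>'" "t \<in> {0..T}"
  shows "\<eta> t = \<eta>' t"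
  by (rule ode_unique[OF T_pos C_pos(3), of "\<lambda>t x. A1 (y l t) (eYZ (R (h t)) - QZ x)"])
    (use assms in \<open>auto simp: eta_sol_def intro: eta_lip\<close>)

lemma eta_0: "l \<in> H1 T \<Longrightarrow> h \<in> H1 T \<Longrightarrow> eta l h 0 = 0"
  and eta_deriv: "l \<in> H1 T \<Longrightarrow> h \<in> H1 T \<Longrightarrow> H1_deriv T (eta l h) (\<lambda>t. A1 (y l t) (p l h t))"
  using eta_sol_eta by (auto simp: eta_sol_def p_def)

lemma p_cont [continuous_intros]: "l \<in> H1 T \<Longrightarrow> h \<in> H1 T \<Longrightarrow> continuous_on {0..T} (p l h)"
  unfolding p_def
  by (intro continuous_intros H1_continuous_on[OF T_nonneg] H1_deriv_continuous_on[OF T_nonneg eta_deriv])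

lemma e_eta_deriv:
  "l \<in> H1 T \<Longrightarrow> h \<in> H1 T \<Longrightarrow> H1_deriv T (\<lambda>t. e (eta l h t)) (\<lambda>t. e (A1 (y l t) (p l h t)))"
  by (intro H1_deriv_blinfun T_pos eta_deriv continuous_intros)

lemma xi_sol_xi:
  assumes l: "l \<in> H1 T" and h: "h \<in> H1 T" and k: "k \<in> H1 T"
  shows "xi_sol l h k (xi l h k)"
proof -
  have "\<exists>\<xi>. \<xi> 0 = 0 \<and> H1_deriv T \<xi> (\<lambda>t. A2 (y l t) (p l h t) (p l k t) - A1W (y l t) (Q (\<xi> t)))"
    by (rule ode_exists[OF T_pos C_pos(3), of "\<lambda>t x. A2 (y l t) (p l h t) (p l k t) - A1W (y l t) (Q x)"])
      (auto intro!: xi_lip continuous_intros l h k)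
  then show ?thesis
    unfolding xi_def xi_sol_def by (rule someI_ex)
qed

lemma xi_unique:
  assumes "xi_sol l h k \<xi>" "xi_sol l h k \<xi>'" "t \<in> {0..T}"
  shows "\<xi> t = \<xi>' t"
  by (rule ode_unique[OF T_pos C_pos(3), of "\<lambda>t x. A2 (y l t) (p l h t) (p l k t) - A1W (y l t) (Q x)"])
    (use assms in \<open>auto simp: xi_sol_def intro: xi_lip\<close>)

lemma xi_0: "l \<in> H1 T \<Longrightarrow> h \<in> H1 T \<Longrightarrow> k \<in> H1 T \<Longrightarrow> xi l h k 0 = 0"
  and xi_deriv: "l \<in> H1 T \<Longrightarrow> h \<in> H1 T \<Longrightarrow> k \<in> H1 T \<Longrightarrow>
    H1_deriv T (xi l h k) (\<lambda>t. A2 (y l t) (p l h t) (p l k t) - A1W (y l t) (Q (xi l h k t)))"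
  using xi_sol_xi by (auto simp: xi_sol_def)

subsection \<open>Linearity\<close>

lemma eta_add:
  assumes l: "l \<in> H1 T" and h: "h \<in> H1 T" and k: "k \<in> H1 T" and t: "t \<in> {0..T}"
  shows "eta l (\<lambda>t. h t + k t) t = eta l h t + eta l k t"
proof (rule eta_unique[OF eta_sol_eta _ t])
  have "H1_deriv T (\<lambda>t. eta l h t + eta l k t) (\<lambda>t. A1 (y l t) (p l h t) + A1 (y l t) (p l k t))"
    by (intro H1_deriv_add eta_deriv l h k)
  then show "eta_sol l (\<lambda>t. h t + k t) (\<lambda>t. eta l h t + eta l k t)"
    unfolding eta_sol_def p_def using eta_0[OF l h] eta_0[OF l k]
    by (simp add: blinfun.add_right blinfun.diff_right algebra_simps)
qed (intro l H1_add h k)+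

lemma eta_scaleR:
  assumes l: "l \<in> H1 T" and h: "h \<in> H1 T" and t: "t \<in> {0..T}"
  shows "eta l (\<lambda>t. c *\<^sub>R h t) t = c *\<^sub>R eta l h t"
proof (rule eta_unique[OF eta_sol_eta _ t])
  have "H1_deriv T (\<lambda>t. c *\<^sub>R eta l h t) (\<lambda>t. c *\<^sub>R A1 (y l t) (p l h t))"
    by (intro H1_deriv_scaleR eta_deriv l h)
  then show "eta_sol l (\<lambda>t. c *\<^sub>R h t) (\<lambda>t. c *\<^sub>R eta l h t)"
    unfolding eta_sol_def p_def using eta_0[OF l h]
    by (simp add: blinfun.scaleR_right blinfun.diff_right scaleR_diff_right)
qed (intro l H1_scaleR h)+

lemma p_add:
  assumes "l \<in> H1 T" "h \<in> H1 T" "k \<in> H1 T" "t \<in> {0..T}"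
  shows "p l (\<lambda>t. h t + k t) t = p l h t + p l k t"
  unfolding p_def using eta_add[OF assms] by (simp add: blinfun.add_right)

lemma p_scaleR:
  assumes "l \<in> H1 T" "h \<in> H1 T" "t \<in> {0..T}"
  shows "p l (\<lambda>t. c *\<^sub>R h t) t = c *\<^sub>R p l h t"
  unfolding p_def using eta_scaleR[OF assms] by (simp add: blinfun.scaleR_right scaleR_diff_right)

text \<open>Superposition plus uniqueness. One statement serves additivity in either slot, with a =
  b = 1, and homogeneity, with b = 0 and the second pair a mere filler.\<close>

lemma xi_combine:
  assumes l: "l \<in> H1 T" and g: "g \<in> H1 T" "g' \<in> H1 T"
    and h: "h \<in> H1 T" "h' \<in> H1 T" and k: "k \<in> H1 T" "k' \<in> H1 T"
    and rhs: "\<And>t. t \<in> {0..T} \<Longrightarrow> A2 (y l t) (p l g t) (p l g' t)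
      = a *\<^sub>R A2 (y l t) (p l h t) (p l h' t) + b *\<^sub>R A2 (y l t) (p l k t) (p l k' t)"
    and t: "t \<in> {0..T}"
  shows "xi l g g' t = a *\<^sub>R xi l h h' t + b *\<^sub>R xi l k k' t"
proof (rule xi_unique[OF xi_sol_xi _ t])
  let ?u = "\<lambda>t. a *\<^sub>R xi l h h' t + b *\<^sub>R xi l k k' t"
  have "H1_deriv T ?u (\<lambda>t. a *\<^sub>R (A2 (y l t) (p l h t) (p l h' t) - A1W (y l t) (Q (xi l h h' t)))
      + b *\<^sub>R (A2 (y l t) (p l k t) (p l k' t) - A1W (y l t) (Q (xi l k k' t))))"
    by (intro H1_deriv_add H1_deriv_scaleR xi_deriv l h k)
  then have "H1_deriv T ?u (\<lambda>t. A2 (y l t) (p l g t) (p l g' t) - A1W (y l t) (Q (?u t)))"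
    by (subst (asm) H1_deriv_cong[OF T_nonneg])
      (auto simp: rhs blinfun.add_right blinfun.scaleR_right scaleR_diff_right)
  then show "xi_sol l g g' ?u"
    unfolding xi_sol_def using xi_0[OF l h] xi_0[OF l k] by simp
qed (intro l g)+

lemma xi_add_left:
  assumes "l \<in> H1 T" "h \<in> H1 T" "h' \<in> H1 T" "k \<in> H1 T" "t \<in> {0..T}"
  shows "xi l (\<lambda>t. h t + h' t) k t = xi l h k t + xi l h' k t"
  using xi_combine[OF assms(1) H1_add[OF assms(2,3)] assms(4) assms(2,4) assms(3,4) _ assms(5), of 1 1]
    assms by (simp add: p_add blinfun.add_left blinfun.add_right)

lemma xi_add_right:
  assumes "l \<in> H1 T" "h \<in> H1 T" "k \<in> H1 T" "k' \<in> H1 T" "t \<in> {0..T}"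
  shows "xi l h (\<lambda>t. k t + k' t) t = xi l h k t + xi l h k' t"
  using xi_combine[OF assms(1) assms(2) H1_add[OF assms(3,4)] assms(2,3) assms(2,4) _ assms(5), of 1 1]
    assms by (simp add: p_add blinfun.add_left blinfun.add_right)

lemma xi_scaleR_left:
  assumes "l \<in> H1 T" "h \<in> H1 T" "k \<in> H1 T" "t \<in> {0..T}"
  shows "xi l (\<lambda>t. c *\<^sub>R h t) k t = c *\<^sub>R xi l h k t"
  using xi_combine[OF assms(1) H1_scaleR[OF assms(2)] assms(3) assms(2,3) assms(2,3) _ assms(4), of c c 0]
    assms by (simp add: p_scaleR blinfun.scaleR_left blinfun.scaleR_right)

lemma xi_scaleR_right:
  assumes "l \<in> H1 T" "h \<in> H1 T" "k \<in> H1 T" "t \<in> {0..T}"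
  shows "xi l h (\<lambda>t. c *\<^sub>R k t) t = c *\<^sub>R xi l h k t"
  using xi_combine[OF assms(1) assms(2) H1_scaleR[OF assms(3)] assms(2,3) assms(2,3) _ assms(4), of c c 0]
    assms by (simp add: p_scaleR blinfun.scaleR_left blinfun.scaleR_right)

subsection \<open>Estimates\<close>

text \<open>The state equation and both linearised ones share the Lipschitz constant
  \<open>C * C\<close>, so one Gronwall constant serves all three.\<close>

definition G :: real where "G = gronwall_const T (C * C)"

text \<open>Lipschitz constant in the supremum norm of the control-to-argument map
  \<open>l \<mapsto> R l - Q z\<close> and of its linearisation.\<close>

definition P :: real where "P = C * C * (1 + G * C * C)"

lemma G_nonneg: "G \<ge> 0"
  unfolding G_def using C_pos by (intro gronwall_const_nonneg T_nonneg)

lemmas gronwall_G = gronwall[OF T_pos C_pos(3), folded G_def]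
  and gronwall_H1norm_G = gronwall_H1norm[OF T_pos C_pos(3), folded G_def]

lemma P_nonneg: "P \<ge> 0"
  unfolding P_def using C_pos G_nonneg by simp

lemma p_bound:
  assumes l: "l \<in> H1 T" and h: "h \<in> H1 T"
    and b: "\<And>t. t \<in> {0..T} \<Longrightarrow> norm (h t) \<le> b" and t: "t \<in> {0..T}"
  shows "norm (p l h t) \<le> P * b"
proof -
  have b0: "b \<ge> 0" using order_trans[OF norm_ge_zero b[OF t]] .
  have Rh: "norm (eYZ (R (h s))) \<le> C * (C * b)" if "s \<in> {0..T}" for s
    by (intro blinfun_apply_bound bounds b that)
  have "norm (eta l h t) \<le> G * (C * (C * (C * b)))"
  proof (rule gronwall_G(1)[OF _ eta_deriv[OF l h] eta_0[OF l h] _ t])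
    fix s assume s: "s \<in> {0..T}"
    have "norm (A1 (y l s) (p l h s)) \<le> C * norm (p l h s)" by (rule apply_le)
    also have "norm (p l h s) \<le> C * (C * b) + C * norm (eta l h s)"
      unfolding p_def by (intro norm_triangle_le_diff add_mono Rh s apply_le)
    finally show "norm (A1 (y l s) (p l h s)) \<le> C * C * norm (eta l h s) + C * (C * (C * b))"
      using C_pos by (simp add: distrib_left mult.assoc)
  qed (use C_pos b0 in auto)
  then have "norm (QZ (eta l h t)) \<le> C * (G * (C * (C * (C * b))))"
    by (intro blinfun_apply_bound bounds)
  then have "norm (p l h t) \<le> C * (C * b) + C * (G * (C * (C * (C * b))))"
    unfolding p_def by (intro norm_triangle_le_diff add_mono Rh t)
  \<comment> \<open>The direct term contributes \<open>C * C * b\<close>, the feedback through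
    \<open>eta\<close> the same times \<open>G * C * C\<close>; this is the origin of
    \<open>P\<close>.\<close>
  also have "\<dots> = P * b" by (simp add: P_def algebra_simps)
  finally show ?thesis .
qed

text \<open>The bound holds in the norm of Y, in which the moduli of \<open>A1\<close> and
  \<open>A2\<close> are given. It rests on the Lipschitz continuity of \<open>A\<close> on Y and
  involves no derivative.\<close>

lemma y_lipschitz:
  assumes l: "l \<in> H1 T" and l': "l' \<in> H1 T"
    and a: "\<And>t. t \<in> {0..T} \<Longrightarrow> norm (l' t - l t) \<le> a" and t: "t \<in> {0..T}"
  shows "norm (y l' t - y l t) \<le> P * a"
proof -
  have a0: "a \<ge> 0" using order_trans[OF norm_ge_zero a[OF t]] .
  let ?d = "\<lambda>t. z l' t - z l t"
  have y_diff: "y l' s - y l s = R (l' s - l s) - QY (?d s)" for s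
    by (simp add: y_def blinfun.diff_right)
  have R: "norm (R (l' s - l s)) \<le> C * a" if "s \<in> {0..T}" for s
    by (intro blinfun_apply_bound bounds a that)
  have "norm (?d t) \<le> G * (C * (C * a))"
  proof (rule gronwall_G(1)[OF _ H1_deriv_diff[OF z_sol(2)[OF l'] z_sol(2)[OF l]] _ _ t])
    fix s assume s: "s \<in> {0..T}"
    have "norm (A (y l' s) - A (y l s)) \<le> C * norm (y l' s - y l s)" by (rule A_lip)
    also have "norm (y l' s - y l s) \<le> C * a + C * norm (?d s)"
      unfolding y_diff by (intro norm_triangle_le_diff add_mono R s apply_le)
    finally show "norm (A (y l' s) - A (y l s)) \<le> C * C * norm (?d s) + C * (C * a)"
      using C_pos by (simp add: distrib_left mult.assoc)
  qed (use C_pos a0 l l' in \<open>auto simp: z_sol\<close>)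
  then have "norm (QY (?d t)) \<le> C * (G * (C * (C * a)))"
    by (intro blinfun_apply_bound bounds)
  then have "norm (y l' t - y l t) \<le> C * a + C * (G * (C * (C * a)))"
    unfolding y_diff by (intro norm_triangle_le_diff add_mono R t)
  also have "\<dots> = 1 * (C * a * (1 + G * C * C))" by (simp add: algebra_simps)
  \<comment> \<open>The estimate so far has one factor \<open>C\<close> less than \<open>P\<close>;
    since \<open>C \<ge> 1\<close>, \<open>P\<close> can serve both here and in
    \<open>p_bound\<close>.\<close>
  also have "\<dots> \<le> C * (C * a * (1 + G * C * C))"
    using C_ge1 C_pos a0 G_nonneg by (intro mult_right_mono) auto
  also have "\<dots> = P * a" by (simp add: P_def)
  finally show ?thesis .
qed

lemma A1_diff_bound:
  assumes "norm (v' - v) \<le> a" "norm x \<le> b"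
  shows "norm ((A1 v' - A1 v) x) \<le> C * a * b"
  using assms C_pos by (intro blinfun_apply_bound order_trans[OF A1_lip] mult_left_mono)

lemma eta_lipschitz:
  assumes l: "l \<in> H1 T" and l': "l' \<in> H1 T" and k: "k \<in> H1 T"
    and a: "\<And>t. t \<in> {0..T} \<Longrightarrow> norm (l' t - l t) \<le> a"
    and b: "\<And>t. t \<in> {0..T} \<Longrightarrow> norm (k t) \<le> b" and t: "t \<in> {0..T}"
  shows "norm (eta l' k t - eta l k t) \<le> G * (C * (P * a) * (P * b))"
proof (rule gronwall_G(1)[OF _ H1_deriv_diff[OF eta_deriv[OF l' k] eta_deriv[OF l k]] _ _ t])
  have "a \<ge> 0" "b \<ge> 0"
    using order_trans[OF norm_ge_zero a[OF t]] order_trans[OF norm_ge_zero b[OF t]] by auto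
  then show "C * (P * a) * (P * b) \<ge> 0" using C_pos P_nonneg by simp
  show "eta l' k 0 - eta l k 0 = 0" using eta_0 l l' k by simp
  fix s assume s: "s \<in> {0..T}"
  let ?d = "eta l' k s - eta l k s"
  \<comment> \<open>The change of coefficient acts on the old \<open>p\<close>, the new coefficient
    on the change of \<open>p\<close>, which is \<open>- QZ ?d\<close>.\<close>
  have "A1 (y l' s) (p l' k s) - A1 (y l s) (p l k s)
      = (A1 (y l' s) - A1 (y l s)) (p l k s) - A1 (y l' s) (QZ ?d)"
    by (simp add: p_def blinfun.diff_left blinfun.diff_right)
  also have "norm \<dots> \<le> C * (P * a) * (P * b) + C * (C * norm ?d)"
    by (intro norm_triangle_le_diff add_mono A1_diff_bound y_lipschitz p_bound blinfun_apply_bound bounds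
        l l' k a b s order_refl)
  finally show "norm (A1 (y l' s) (p l' k s) - A1 (y l s) (p l k s))
      \<le> C * C * norm ?d + C * (P * a) * (P * b)"
    by simp
qed

text \<open>Mean value estimate along the segment, on which \<open>A1\<close> varies by at most
  \<open>C * norm (v' - v)\<close>; the last \<open>C\<close> bounds the embedding of Y into
  Z.\<close>

lemma A_taylor: "norm (eYZ (A v') - eYZ (A v) - A1 v (eYZ (v' - v))) \<le> norm (v' - v) * (C * norm (v' - v) * C)"
proof (rule differentiable_bound_linearization[where S = "closed_segment v v'"])
  show "((\<lambda>y. eYZ (A y)) has_derivative (\<lambda>k. A1 x (eYZ k))) (at x within closed_segment v v')" for x
    using A_deriv has_derivative_at_withinI by blast
  show "v + t *\<^sub>R (v' - v) \<in> closed_segment v v'" if "t \<in> {0..1}" for t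
    using that by (auto simp: closed_segment_def algebra_simps intro!: exI[of _ t])
  fix x assume x: "x \<in> closed_segment v v'"
  show "onorm ((\<lambda>k. A1 x (eYZ k)) - (\<lambda>k. A1 v (eYZ k))) \<le> C * norm (v' - v) * C"
  proof (rule onorm_bound)
    show "0 \<le> C * norm (v' - v) * C" using C_pos by simp
    fix k
    have "norm (x - v) \<le> norm (v' - v)"
      using segment_bound1[OF x] .
    then have "norm ((A1 x - A1 v) (eYZ k)) \<le> C * norm (v' - v) * (C * norm k)"
      by (rule A1_diff_bound[OF _ apply_le(2)])
    then show "norm (((\<lambda>k. A1 x (eYZ k)) - (\<lambda>k. A1 v (eYZ k))) k) \<le> C * norm (v' - v) * C * norm k"
      by (simp add: blinfun.diff_left mult.assoc)
  qed
qed simp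

text \<open>\<open>A2\<close> is only assumed continuous, so its oscillation over a ball about v is
  kept as the parameter \<open>\<omega>\<close>; the segment from v to v' stays in that
  ball.\<close>

lemma A1_taylor:
  assumes "\<And>x. norm (x - v) \<le> norm (v' - v) \<Longrightarrow> norm (A2 x - A2 v) \<le> \<omega>"
  shows "norm ((e o\<^sub>L A1 v') - (e o\<^sub>L A1 v) - A2 v (eYZ (v' - v))) \<le> norm (v' - v) * (\<omega> * C)"
proof (rule differentiable_bound_linearization[where S = "closed_segment v v'"])
  show "((\<lambda>y. e o\<^sub>L A1 y) has_derivative (\<lambda>k. A2 x (eYZ k))) (at x within closed_segment v v')" for x
    using A1_deriv has_derivative_at_withinI by blast
  show "v + t *\<^sub>R (v' - v) \<in> closed_segment v v'" if "t \<in> {0..1}" for t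
    using that by (auto simp: closed_segment_def algebra_simps intro!: exI[of _ t])
  fix x assume x: "x \<in> closed_segment v v'"
  have le: "norm (A2 x - A2 v) \<le> \<omega>"
    by (rule assms[OF segment_bound1[OF x]])
  show "onorm ((\<lambda>k. A2 x (eYZ k)) - (\<lambda>k. A2 v (eYZ k))) \<le> \<omega> * C"
  proof (rule onorm_bound)
    show "0 \<le> \<omega> * C" using C_pos order_trans[OF norm_ge_zero le] by simp
    fix k
    have "norm ((A2 x - A2 v) (eYZ k)) \<le> \<omega> * (C * norm k)"
      by (rule blinfun_apply_bound[OF le apply_le(2)])
    then show "norm (((\<lambda>k. A2 x (eYZ k)) - (\<lambda>k. A2 v (eYZ k))) k) \<le> \<omega> * C * norm k"
      by (simp add: blinfun.diff_left mult.assoc)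
  qed
qed simp

text \<open>Taken in Z and not yet in W, because the second-order expansion inserts it into
  \<open>A2\<close>, whose arguments live in Z.\<close>

definition rem :: "(real \<Rightarrow> 'x) \<Rightarrow> (real \<Rightarrow> 'x) \<Rightarrow> real \<Rightarrow> 'z" where
  "rem l h t = eYZ (z (\<lambda>s. l s + h s) t) - eYZ (z l t) - eta l h t"

text \<open>Exchange rule between the actual increment of the argument, in which Taylor's formula is
  written, and the linearised one, in which the equations for \<open>eta\<close> and
  \<open>xi\<close> are written.\<close>

lemma eYZ_y_diff:
  "eYZ (y (\<lambda>s. l s + h s) t - y l t) = p l h t - QZ (rem l h t)"
  by (simp add: y_def p_def rem_def blinfun.diff_right blinfun.add_right eYZ_QY)

lemma eYZ_z_deriv:
  "l \<in> H1 T \<Longrightarrow> H1_deriv T (\<lambda>t. eYZ (z l t)) (\<lambda>t. eYZ (A (y l t)))"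
  by (intro H1_deriv_blinfun T_pos z_sol continuous_intros)

lemma rem_deriv:
  assumes l: "l \<in> H1 T" and h: "h \<in> H1 T"
  shows "H1_deriv T (rem l h) (\<lambda>t. eYZ (A (y (\<lambda>s. l s + h s) t)) - eYZ (A (y l t)) - A1 (y l t) (p l h t))"
  unfolding rem_def[abs_def] by (intro H1_deriv_diff eYZ_z_deriv eta_deriv l h H1_add)

text \<open>The Taylor remainder of \<open>A\<close> is quadratic by \<open>A_taylor\<close> and
  \<open>y_lipschitz\<close>. Exchanging the increment for \<open>p\<close> costs a term linear in
  \<open>rem\<close>, which Gronwall absorbs. The second bound concerns the time derivative, as the
  H1 norm demands.\<close>

lemma rem_bound:
  assumes l: "l \<in> H1 T" and h: "h \<in> H1 T"
    and a: "\<And>t. t \<in> {0..T} \<Longrightarrow> norm (h t) \<le> a" and t: "t \<in> {0..T}"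
  shows "norm (rem l h t) \<le> G * (P * a * (C * (P * a) * C))"
    "norm (eYZ (A (y (\<lambda>s. l s + h s) t)) - eYZ (A (y l t)) - A1 (y l t) (p l h t))
      \<le> G * (P * a * (C * (P * a) * C))"
proof -
  have lh: "(\<lambda>s. l s + h s) \<in> H1 T" by (rule H1_add[OF l h])
  have a0: "a \<ge> 0" using order_trans[OF norm_ge_zero a[OF t]] .
  have M: "0 \<le> P * a * (C * (P * a) * C)" using a0 P_nonneg C_pos by simp
  have rem0: "rem l h 0 = 0" by (simp add: rem_def z_sol[OF l] z_sol[OF lh] eta_0[OF l h])
  have bound: "norm (eYZ (A (y (\<lambda>s. l s + h s) s)) - eYZ (A (y l s)) - A1 (y l s) (p l h s))
      \<le> C * C * norm (rem l h s) + P * a * (C * (P * a) * C)" if s: "s \<in> {0..T}" for s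
  proof -
    let ?v = "y l s" and ?v' = "y (\<lambda>s. l s + h s) s"
    have v: "norm (?v' - ?v) \<le> P * a"
      using a by (intro y_lipschitz l lh s) auto
    have "norm (eYZ (A ?v') - eYZ (A ?v) - A1 ?v (eYZ (?v' - ?v))) \<le> norm (?v' - ?v) * (C * norm (?v' - ?v) * C)"
      by (rule A_taylor)
    also have "\<dots> \<le> P * a * (C * (P * a) * C)"
      using v C_pos P_nonneg a0 by (intro mult_mono) auto
    finally have taylor: "norm (eYZ (A ?v') - eYZ (A ?v) - A1 ?v (eYZ (?v' - ?v))) \<le> P * a * (C * (P * a) * C)" .
    have "eYZ (A ?v') - eYZ (A ?v) - A1 ?v (p l h s)
        = (eYZ (A ?v') - eYZ (A ?v) - A1 ?v (eYZ (?v' - ?v))) - A1 ?v (QZ (rem l h s))"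
      by (simp add: eYZ_y_diff blinfun.diff_right[of "A1 ?v"])
    also have "norm \<dots> \<le> P * a * (C * (P * a) * C) + C * (C * norm (rem l h s))"
      by (intro norm_triangle_le_diff add_mono taylor blinfun_apply_bound bounds order_refl)
    finally show ?thesis by simp
  qed
  show "norm (rem l h t) \<le> G * (P * a * (C * (P * a) * C))"
    by (rule gronwall_G(1)[OF M rem_deriv[OF l h] rem0 bound t])
  show "norm (eYZ (A (y (\<lambda>s. l s + h s) t)) - eYZ (A (y l t)) - A1 (y l t) (p l h t))
      \<le> G * (P * a * (C * (P * a) * C))"
    by (rule gronwall_G(2)[OF M rem_deriv[OF l h] rem0 bound t])
qed

section \<open>Second-order estimates: boundedness, remainder and dependence on the control\<close>

lemma xi_bound:
  assumes l: "l \<in> H1 T" and h: "h \<in> H1 T" and k: "k \<in> H1 T"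
    and a: "\<And>t. t \<in> {0..T} \<Longrightarrow> norm (h t) \<le> a"
    and b: "\<And>t. t \<in> {0..T} \<Longrightarrow> norm (k t) \<le> b"
  shows "t \<in> {0..T} \<Longrightarrow> norm (xi l h k t) \<le> G * (C * (P * a) * (P * b))"
    and "H1norm T (xi l h k) \<le> sqrt (2 * T) * G * (C * (P * a) * (P * b))"
proof -
  have "a \<ge> 0" "b \<ge> 0"
    using order_trans[OF norm_ge_zero a[of 0]] order_trans[OF norm_ge_zero b[of 0]] T_nonneg by auto
  then have M: "C * (P * a) * (P * b) \<ge> 0" using C_pos P_nonneg by simp
  have bound: "norm (A2 (y l s) (p l h s) (p l k s) - A1W (y l s) (Q (xi l h k s)))
      \<le> C * C * norm (xi l h k s) + C * (P * a) * (P * b)" if s: "s \<in> {0..T}" for s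
  proof -
    have "norm (A2 (y l s) (p l h s) (p l k s) - A1W (y l s) (Q (xi l h k s)))
        \<le> C * (P * a) * (P * b) + C * (C * norm (xi l h k s))"
      by (intro norm_triangle_le_diff add_mono blinfun_apply_bound bounds p_bound l h k a b s order_refl)
    then show ?thesis by simp
  qed
  show "norm (xi l h k t) \<le> G * (C * (P * a) * (P * b))" if "t \<in> {0..T}"
    by (rule gronwall_G(1)[OF M xi_deriv[OF l h k] xi_0[OF l h k] bound that])
  show "H1norm T (xi l h k) \<le> sqrt (2 * T) * G * (C * (P * a) * (P * b))"
    by (rule gronwall_H1norm_G[OF M xi_deriv[OF l h k] xi_0[OF l h k] bound])
qed

text \<open>Feedback terms computed in Z are recognised, once embedded, as the feedback of the
  equation in W.\<close>

lemma e_A1_Q: "e (A1 v (QZ x)) = A1W v (Q (e x))"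
  by (simp add: A1W_e[symmetric] e_QZ)

text \<open>The three summands are three defects: the Taylor remainder of \<open>A1\<close>, of
  order \<omega> * a * b; \<open>A2\<close> applied to the first remainder, of order a * a * b; and
  the change of \<open>A1\<close> acting on the change of \<open>eta\<close>, again of order a * a *
  b.\<close>

lemma xi_remainder:
  assumes l: "l \<in> H1 T" and h: "h \<in> H1 T" and k: "k \<in> H1 T"
    and a: "\<And>t. t \<in> {0..T} \<Longrightarrow> norm (h t) \<le> a"
    and b: "\<And>t. t \<in> {0..T} \<Longrightarrow> norm (k t) \<le> b"
    and \<omega>: "\<And>t x. t \<in> {0..T} \<Longrightarrow> norm (x - y l t) \<le> P * a \<Longrightarrow> norm (A2 x - A2 (y l t)) \<le> \<omega>"
  shows "H1norm T (\<lambda>t. e (eta (\<lambda>s. l s + h s) k t) - e (eta l k t) - xi l h k t)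
    \<le> sqrt (2 * T) * G * ((P * a * (\<omega> * C)) * (P * b)
        + C * (C * (G * (P * a * (C * (P * a) * C)))) * (P * b)
        + C * (C * (P * a) * (C * (G * (C * (P * a) * (P * b))))))"
    (is "H1norm T ?w \<le> _ * ?M")
proof -
  let ?l' = "\<lambda>s. l s + h s"
  have l': "?l' \<in> H1 T" by (rule H1_add[OF l h])
  have "a \<ge> 0" "b \<ge> 0"
    using order_trans[OF norm_ge_zero a[of 0]] order_trans[OF norm_ge_zero b[of 0]] T_nonneg by auto
  moreover have "\<omega> \<ge> 0"
    using order_trans[OF norm_ge_zero \<omega>[of 0 "y l 0"]] T_nonneg \<open>a \<ge> 0\<close> P_nonneg by simp
  ultimately have M: "?M \<ge> 0"
    using C_pos P_nonneg G_nonneg by (intro add_nonneg_nonneg mult_nonneg_nonneg) auto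
  have deriv: "H1_deriv T ?w (\<lambda>t. e (A1 (y ?l' t) (p ?l' k t)) - e (A1 (y l t) (p l k t))
      - (A2 (y l t) (p l h t) (p l k t) - A1W (y l t) (Q (xi l h k t))))"
    by (intro H1_deriv_diff e_eta_deriv xi_deriv l l' h k)
  show ?thesis
  proof (rule gronwall_H1norm_G[OF M deriv])
    show "?w 0 = 0" by (simp add: eta_0 xi_0 l l' h k)
    fix s assume s: "s \<in> {0..T}"
    let ?v = "y l s" and ?v' = "y ?l' s" and ?d = "eta ?l' k s - eta l k s"
    let ?B = "(e o\<^sub>L A1 ?v') - (e o\<^sub>L A1 ?v) - A2 ?v (eYZ (?v' - ?v))"
    have v: "norm (?v' - ?v) \<le> P * a"
      using a by (intro y_lipschitz l l' s) auto
    have d: "norm ?d \<le> G * (C * (P * a) * (P * b))"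
      using a by (intro eta_lipschitz l l' k b s) auto
    have "norm ?B \<le> norm (?v' - ?v) * (\<omega> * C)"
      using v by (intro A1_taylor \<omega> s) auto
    also have "\<dots> \<le> P * a * (\<omega> * C)"
      using v C_pos \<open>\<omega> \<ge> 0\<close> by (intro mult_right_mono) auto
    finally have B: "norm ?B \<le> P * a * (\<omega> * C)" .
    have p': "p ?l' k s = p l k s - QZ ?d"
      by (simp add: p_def blinfun.diff_right)
    have terms: "?B (p l k s) = e (A1 ?v' (p l k s)) - e (A1 ?v (p l k s))
          - (A2 ?v (p l h s) (p l k s) - A2 ?v (QZ (rem l h s)) (p l k s))"
      "e ((A1 ?v' - A1 ?v) (QZ ?d)) = e (A1 ?v' (QZ ?d)) - A1W ?v (Q (e ?d))"
      "A1W ?v (Q (?w s)) = A1W ?v (Q (e ?d)) - A1W ?v (Q (xi l h k s))"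
      "e (A1 ?v' (p ?l' k s)) = e (A1 ?v' (p l k s)) - e (A1 ?v' (QZ ?d))"
      unfolding eYZ_y_diff p' e_A1_Q[of ?v, symmetric]
      by (simp_all only: blinfun.diff_left blinfun.diff_right blinfun_apply_blinfun_compose e_A1_Q)
        (simp add: algebra_simps)
    \<comment> \<open>Besides the three defects only \<open>A1W ?v (Q (?w s))\<close> remains, the
      feedback on the unknown itself, which Gronwall absorbs.\<close>
    have split: "e (A1 ?v' (p ?l' k s)) - e (A1 ?v (p l k s))
        - (A2 ?v (p l h s) (p l k s) - A1W ?v (Q (xi l h k s)))
      = ?B (p l k s) - A2 ?v (QZ (rem l h s)) (p l k s) - e ((A1 ?v' - A1 ?v) (QZ ?d)) - A1W ?v (Q (?w s))"
      unfolding terms by simp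
    have "norm (?B (p l k s) - A2 ?v (QZ (rem l h s)) (p l k s) - e ((A1 ?v' - A1 ?v) (QZ ?d)) - A1W ?v (Q (?w s)))
        \<le> (P * a * (\<omega> * C)) * (P * b)
          + C * (C * (G * (P * a * (C * (P * a) * C)))) * (P * b)
          + C * (C * (P * a) * (C * (G * (C * (P * a) * (P * b)))))
          + C * (C * norm (?w s))"
      by (intro norm_triangle_le_diff add_mono blinfun_apply_bound[OF B] A1_diff_bound
          blinfun_apply_bound bounds p_bound rem_bound l h k a b s v d order_refl)
    then show "norm (e (A1 ?v' (p ?l' k s)) - e (A1 ?v (p l k s))
        - (A2 ?v (p l h s) (p l k s) - A1W ?v (Q (xi l h k s)))) \<le> C * C * norm (?w s) + ?M"
      unfolding split by simp
  qed
qed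

text \<open>Telescoping over the four ingredients of the equation: \<open>A2\<close>, its two
  arguments and \<open>A1W\<close>. Here the Lipschitz constant of \<open>A1W\<close> enters the
  estimates.\<close>

lemma xi_continuity:
  assumes l: "l \<in> H1 T" and l': "l' \<in> H1 T" and h: "h \<in> H1 T" and k: "k \<in> H1 T"
    and a: "\<And>t. t \<in> {0..T} \<Longrightarrow> norm (l' t - l t) \<le> a"
    and b: "\<And>t. t \<in> {0..T} \<Longrightarrow> norm (h t) \<le> b"
    and c: "\<And>t. t \<in> {0..T} \<Longrightarrow> norm (k t) \<le> c"
    and \<omega>: "\<And>t x. t \<in> {0..T} \<Longrightarrow> norm (x - y l t) \<le> P * a \<Longrightarrow> norm (A2 x - A2 (y l t)) \<le> \<omega>"
  shows "H1norm T (\<lambda>t. xi l' h k t - xi l h k t)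
    \<le> sqrt (2 * T) * G * (\<omega> * (P * b) * (P * c)
        + C * (C * (G * (C * (P * a) * (P * b)))) * (P * c)
        + C * (P * b) * (C * (G * (C * (P * a) * (P * c))))
        + C * (P * a) * (C * (G * (C * (P * b) * (P * c)))))"
    (is "H1norm T ?w \<le> _ * ?M")
proof -
  have "a \<ge> 0" "b \<ge> 0" "c \<ge> 0"
    using order_trans[OF norm_ge_zero a[of 0]] order_trans[OF norm_ge_zero b[of 0]]
      order_trans[OF norm_ge_zero c[of 0]] T_nonneg by auto
  moreover have "\<omega> \<ge> 0"
    using order_trans[OF norm_ge_zero \<omega>[of 0 "y l 0"]] T_nonneg \<open>a \<ge> 0\<close> P_nonneg by simp
  ultimately have M: "?M \<ge> 0"
    using C_pos P_nonneg G_nonneg by (intro add_nonneg_nonneg mult_nonneg_nonneg) auto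
  have deriv: "H1_deriv T ?w (\<lambda>t. A2 (y l' t) (p l' h t) (p l' k t) - A1W (y l' t) (Q (xi l' h k t))
      - (A2 (y l t) (p l h t) (p l k t) - A1W (y l t) (Q (xi l h k t))))"
    by (intro H1_deriv_diff xi_deriv l l' h k)
  show ?thesis
  proof (rule gronwall_H1norm_G[OF M deriv])
    show "?w 0 = 0" by (simp add: xi_0 l l' h k)
    fix s assume s: "s \<in> {0..T}"
    let ?v = "y l s" and ?v' = "y l' s"
    let ?d = "\<lambda>h. eta l' h s - eta l h s"
    have v: "norm (?v' - ?v) \<le> P * a"
      by (intro y_lipschitz l l' s a)
    have dW: "norm (A1W ?v' - A1W ?v) \<le> C * (P * a)"
      using v C_pos by (intro order_trans[OF A1W_lip] mult_left_mono)
    have QZ_d: "QZ (?d h) = p l h s - p l' h s" for h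
      by (simp add: p_def blinfun.diff_right)
    have split: "A2 ?v' (p l' h s) (p l' k s) - A1W ?v' (Q (xi l' h k s))
        - (A2 ?v (p l h s) (p l k s) - A1W ?v (Q (xi l h k s)))
      = (A2 ?v' - A2 ?v) (p l' h s) (p l' k s) - A2 ?v (QZ (?d h)) (p l' k s) - A2 ?v (p l h s) (QZ (?d k))
        - (A1W ?v' - A1W ?v) (Q (xi l' h k s)) - A1W ?v (Q (?w s))"
      unfolding QZ_d blinfun.diff_left blinfun.diff_right[of "A2 _"] blinfun.diff_right[of "A2 _ _"]
        blinfun.diff_right[of Q] blinfun.diff_right[of "A1W _"] by simp
    have "norm ((A2 ?v' - A2 ?v) (p l' h s) (p l' k s) - A2 ?v (QZ (?d h)) (p l' k s) - A2 ?v (p l h s) (QZ (?d k))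
        - (A1W ?v' - A1W ?v) (Q (xi l' h k s)) - A1W ?v (Q (?w s)))
        \<le> \<omega> * (P * b) * (P * c)
        + C * (C * (G * (C * (P * a) * (P * b)))) * (P * c)
        + C * (P * b) * (C * (G * (C * (P * a) * (P * c))))
        + C * (P * a) * (C * (G * (C * (P * b) * (P * c))))
        + C * (C * norm (?w s))"
      by (intro norm_triangle_le_diff add_mono blinfun_apply_bound[OF dW]
          blinfun_apply_bound[OF blinfun_apply_bound[OF \<omega>[OF s v]]]
          blinfun_apply_bound bounds p_bound eta_lipschitz xi_bound(1) l l' h k a b c s order_refl)
    then show "norm (A2 ?v' (p l' h s) (p l' k s) - A1W ?v' (Q (xi l' h k s))
        - (A2 ?v (p l h s) (p l k s) - A1W ?v (Q (xi l h k s)))) \<le> C * C * norm (?w s) + ?M"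
      unfolding split by simp
  qed
qed

text \<open>The radius may depend on l but not on t; this suffices because differentiability and
  continuity are tested at one l at a time.\<close>

lemma A2_modulus:
  assumes l: "l \<in> H1 T" and \<epsilon>: "\<epsilon> > 0"
  obtains \<delta> where "\<delta> > 0"
    "\<And>t x. t \<in> {0..T} \<Longrightarrow> norm (x - y l t) < \<delta> \<Longrightarrow> norm (A2 x - A2 (y l t)) \<le> \<epsilon>"
proof -
  have "compact (y l ` {0..T})"
    using y_cont[OF l] by (rule compact_continuous_image) auto
  then obtain \<delta> where "\<delta> > 0"
      "\<And>v x. v \<in> y l ` {0..T} \<Longrightarrow> dist v x < \<delta> \<Longrightarrow> dist (A2 v) (A2 x) < \<epsilon>"
    using continuous_near_compact[OF A2_cont _ \<epsilon>] by metis
  then show ?thesis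
    by (intro that[of \<delta>]) (force simp: dist_norm norm_minus_commute intro: less_imp_le)+
qed

subsection \<open>Differentiability\<close>

definition emb_const :: real where "emb_const = (T + 1) * (1/2 + T) / T"

lemma emb_const_nonneg: "emb_const \<ge> 0"
  unfolding emb_const_def using T_pos by simp

lemma sup_bound: "h \<in> H1 T \<Longrightarrow> t \<in> {0..T} \<Longrightarrow> norm (h t :: 'x) \<le> emb_const * H1norm T h"
  unfolding emb_const_def by (rule H1_sup_bound[OF T_pos])

lemma sup_bound_diff:
  "l \<in> H1 T \<Longrightarrow> l' \<in> H1 T \<Longrightarrow> t \<in> {0..T} \<Longrightarrow>
    norm (l' t - l t :: 'x) \<le> emb_const * H1norm T (\<lambda>t. l' t - l t)"
  using sup_bound[OF H1_diff] by blast

lemma e_eta_linop: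
  assumes l: "l \<in> H1 T"
  shows "H1_linop T (\<lambda>h t. e (eta l h t))"
  unfolding H1_linop_def
proof (intro conjI ballI allI)
  fix h :: "real \<Rightarrow> 'x" assume h: "h \<in> H1 T"
  show "(\<lambda>t. e (eta l h t)) \<in> H1 T"
    using e_eta_deriv[OF l h] by (auto simp: H1_def)
  fix k :: "real \<Rightarrow> 'x" assume k: "k \<in> H1 T"
  show "eq_on T (\<lambda>t. e (eta l (\<lambda>t. h t + k t) t)) (\<lambda>t. e (eta l h t) + e (eta l k t))"
    unfolding eq_on_def using eta_add[OF l h k] by (simp add: blinfun.add_right)
next
  fix h :: "real \<Rightarrow> 'x" and c assume h: "h \<in> H1 T"
  show "eq_on T (\<lambda>t. e (eta l (\<lambda>t. c *\<^sub>R h t) t)) (\<lambda>t. c *\<^sub>R e (eta l h t))"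
    unfolding eq_on_def using eta_scaleR[OF l h] by (simp add: blinfun.scaleR_right)
next
  show "\<exists>K. \<forall>h\<in>H1 T. H1norm T (\<lambda>t. e (eta l h t)) \<le> K * H1norm T h"
  proof (intro exI ballI)
    fix h :: "real \<Rightarrow> 'x" assume h: "h \<in> H1 T"
    let ?N = "emb_const * H1norm T h"
    have "H1norm T (\<lambda>t. e (eta l h t)) \<le> sqrt (2 * T) * G * (C * (C * (P * ?N)))"
    proof (rule gronwall_H1norm_G[OF _ e_eta_deriv[OF l h]])
      show "0 \<le> C * (C * (P * ?N))"
        using C_pos P_nonneg emb_const_nonneg H1norm_nonneg[of T h] by simp
      show "e (eta l h 0) = 0" by (simp add: eta_0[OF l h])
      fix t assume t: "t \<in> {0..T}"
      have "norm (e (A1 (y l t) (p l h t))) \<le> C * (C * (P * ?N))"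
        by (intro blinfun_apply_bound bounds p_bound l h t sup_bound)
      \<comment> \<open>The derivative is already bounded by the data; the nonnegative term is added
        only to match the form of Gronwall's hypothesis.\<close>
      then show "norm (e (A1 (y l t) (p l h t))) \<le> C * C * norm (e (eta l h t)) + C * (C * (P * ?N))"
        using C_pos by (simp add: add_increasing)
    qed
    then show "H1norm T (\<lambda>t. e (eta l h t)) \<le> (sqrt (2 * T) * G * (C * (C * (P * emb_const)))) * H1norm T h"
      by (simp add: mult.assoc)
  qed
qed

lemma solution_frechet:
  assumes l: "l \<in> H1 T"
  shows "H1_frechet T (\<lambda>l t. e (eYZ (z l t))) (\<lambda>h t. e (eta l h t)) l"
  unfolding H1_frechet_def
proof (intro conjI e_eta_linop l allI impI)
  fix \<epsilon> :: real assume \<epsilon>: "\<epsilon> > 0"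
  define \<kappa> where "\<kappa> = sqrt (2 * T) * (C * (G * (P * emb_const * (C * (P * emb_const) * C))))"
  have \<kappa>: "\<kappa> \<ge> 0"
    unfolding \<kappa>_def using C_pos G_nonneg P_nonneg emb_const_nonneg T_pos by simp
  have quad: "H1norm T (\<lambda>t. e (eYZ (z (\<lambda>s. l s + h s) t)) - e (eYZ (z l t)) - e (eta l h t))
      \<le> \<kappa> * H1norm T h * H1norm T h" if h: "h \<in> H1 T" for h
  proof -
    let ?N = "emb_const * H1norm T h"
    let ?M = "G * (P * ?N * (C * (P * ?N) * C))"
    let ?v = "\<lambda>t. eYZ (A (y (\<lambda>s. l s + h s) t)) - eYZ (A (y l t)) - A1 (y l t) (p l h t)"
    have N: "?N \<ge> 0" using emb_const_nonneg H1norm_nonneg[of T h] by simp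
    have M: "?M \<ge> 0"
      by (intro mult_nonneg_nonneg N C_pos G_nonneg P_nonneg emb_const_nonneg H1norm_nonneg)
    have "H1_deriv T (\<lambda>t. e (rem l h t)) (\<lambda>t. e (?v t))"
      by (intro H1_deriv_blinfun T_pos rem_deriv continuous_intros l h H1_add)
    then have "H1norm T (\<lambda>t. e (rem l h t)) \<le> sqrt (2 * T) * (C * ?M)"
      by (rule H1norm_le[OF T_pos])
        (intro mult_nonneg_nonneg C_pos M blinfun_apply_bound bounds rem_bound l h sup_bound; assumption)+
    then show ?thesis
      unfolding rem_def blinfun.diff_right \<kappa>_def by (simp add: mult.assoc mult.commute mult.left_commute)
  qed
  show "\<exists>\<delta>>0. \<forall>h\<in>H1 T. H1norm T h < \<delta> \<longrightarrow>
      H1norm T (\<lambda>t. e (eYZ (z (\<lambda>s. l s + h s) t)) - e (eYZ (z l t)) - e (eta l h t)) \<le> \<epsilon> * H1norm T h"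
  proof (intro exI conjI ballI impI)
    \<comment> \<open>The summand 1 covers the case \<open>\<kappa> = 0\<close>.\<close>
    show "0 < \<epsilon> / (\<kappa> + 1)" using \<epsilon> \<kappa> by simp
    fix h :: "real \<Rightarrow> 'x" assume h: "h \<in> H1 T" and less: "H1norm T h < \<epsilon> / (\<kappa> + 1)"
    then have "(\<kappa> + 1) * H1norm T h \<le> \<epsilon>"
      using \<kappa> by (simp add: field_simps)
    then have "\<kappa> * H1norm T h \<le> \<epsilon>"
      using H1norm_nonneg[of T h] by (simp add: algebra_simps)
    then show "H1norm T (\<lambda>t. e (eYZ (z (\<lambda>s. l s + h s) t)) - e (eYZ (z l t)) - e (eta l h t)) \<le> \<epsilon> * H1norm T h"
      by (intro order_trans[OF quad[OF h]] mult_right_mono H1norm_nonneg)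
  qed
qed

text \<open>The factor is built from T and C alone, hence the uniformity in l that the theorem
  claims.\<close>

lemma xi_H1_bound:
  assumes "l \<in> H1 T" "h \<in> H1 T" "k \<in> H1 T"
  shows "H1norm T (xi l h k)
    \<le> (sqrt (2 * T) * G * (C * (P * emb_const) * (P * emb_const))) * H1norm T h * H1norm T k"
  using xi_bound(2)[OF assms sup_bound[OF assms(2)] sup_bound[OF assms(3)]]
  by (simp add: mult.assoc mult.commute mult.left_commute)

lemma xi_bilinop:
  assumes l: "l \<in> H1 T"
  shows "H1_bilinop T (xi l)"
proof -
  have H1: "xi l h k \<in> H1 T" if "h \<in> H1 T" "k \<in> H1 T" for h k
    using xi_deriv[OF l that] by (auto simp: H1_def)
  let ?K = "sqrt (2 * T) * G * (C * (P * emb_const) * (P * emb_const))"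
  have "H1_linop T (xi l h)" if h: "h \<in> H1 T" for h
    unfolding H1_linop_def eq_on_def using xi_H1_bound[OF l h]
    by (auto simp: H1 h l xi_add_right xi_scaleR_right intro!: exI[of _ "?K * H1norm T h"])
  moreover have "H1_linop T (\<lambda>h. xi l h k)" if k: "k \<in> H1 T" for k
    unfolding H1_linop_def eq_on_def using xi_H1_bound[OF l _ k]
    by (auto simp: H1 k l xi_add_left xi_scaleR_left mult.assoc mult.commute mult.left_commute
        intro!: exI[of _ "?K * H1norm T k"])
  moreover have "\<exists>K. \<forall>h\<in>H1 T. \<forall>k\<in>H1 T. H1norm T (xi l h k) \<le> K * H1norm T h * H1norm T k"
    using xi_H1_bound[OF l] by blast
  ultimately show ?thesis
    unfolding H1_bilinop_def by blast
qed

text \<open>Both second-order estimates have the shape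
  \<open>\<kappa>1 * \<omega> + \<kappa>2 * N\<close> times the norms of the two directions, N being
  the norm of the increment of the control. The oscillation \<open>\<omega>\<close> is fixed first;
  \<open>\<delta>\<close> then follows from \<open>A2_modulus\<close>.\<close>

lemma A2_modulus_small:
  assumes l: "l \<in> H1 T" and \<epsilon>: "\<epsilon> > 0" and \<kappa>: "\<kappa>1 \<ge> 0" "\<kappa>2 \<ge> 0"
  obtains \<omega> \<delta> where "\<delta> > 0"
    "\<And>N. 0 \<le> N \<Longrightarrow> N < \<delta> \<Longrightarrow> \<kappa>1 * \<omega> + \<kappa>2 * N \<le> \<epsilon>"
    "\<And>N t x. N < \<delta> \<Longrightarrow> t \<in> {0..T} \<Longrightarrow> norm (x - y l t) \<le> P * (emb_const * N) \<Longrightarrow>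
      norm (A2 x - A2 (y l t)) \<le> \<omega>"
proof -
  define \<omega> where "\<omega> = \<epsilon> / (2 * (\<kappa>1 + 1))"
  have \<omega>: "\<omega> > 0" using \<epsilon> \<kappa> by (simp add: \<omega>_def)
  obtain \<rho> where \<rho>: "\<rho> > 0"
      "\<And>t x. t \<in> {0..T} \<Longrightarrow> norm (x - y l t) < \<rho> \<Longrightarrow> norm (A2 x - A2 (y l t)) \<le> \<omega>"
    using A2_modulus[OF l \<omega>] by metis
  define q where "q = P * emb_const"
  have q: "q \<ge> 0" using P_nonneg emb_const_nonneg by (simp add: q_def)
  \<comment> \<open>The first entry keeps the argument within \<open>\<rho>\<close> of the orbit,
    the second gives \<open>\<kappa>2 * N \<le> \<epsilon> / 2\<close>.\<close>
  define \<delta> where "\<delta> = min (\<rho> / (q + 1)) (\<epsilon> / (2 * (\<kappa>2 + 1)))"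
  show ?thesis
  proof (rule that[of \<delta> \<omega>])
    show "\<delta> > 0" using \<rho> q \<epsilon> \<kappa> by (simp add: \<delta>_def)
    fix N
    show "\<kappa>1 * \<omega> + \<kappa>2 * N \<le> \<epsilon>" if "0 \<le> N" "N < \<delta>"
    proof -
      have "\<kappa>1 * \<omega> \<le> (\<kappa>1 + 1) * \<omega>" using \<omega> by simp
      moreover have "(\<kappa>1 + 1) * \<omega> = \<epsilon> / 2" using \<kappa>(1) by (simp add: \<omega>_def divide_simps)
      moreover have "\<kappa>2 * N \<le> (\<kappa>2 + 1) * (\<epsilon> / (2 * (\<kappa>2 + 1)))"
        using that \<kappa> by (intro mult_mono) (auto simp: \<delta>_def)
      moreover have "(\<kappa>2 + 1) * (\<epsilon> / (2 * (\<kappa>2 + 1))) = \<epsilon> / 2" using \<kappa>(2) by (simp add: divide_simps)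
      ultimately show ?thesis by linarith
    qed
    fix t x assume N: "N < \<delta>" and t: "t \<in> {0..T}" and x: "norm (x - y l t) \<le> P * (emb_const * N)"
    have "q * N \<le> q * (\<rho> / (q + 1))"
      using N q by (intro mult_left_mono) (auto simp: \<delta>_def)
    also have "\<dots> < \<rho>" using q \<rho>(1) by (simp add: field_simps)
    finally show "norm (A2 x - A2 (y l t)) \<le> \<omega>"
      using x t by (intro \<rho>(2)) (auto simp: q_def)
  qed
qed

lemma derivative_frechet:
  assumes l: "l \<in> H1 T"
  shows "H1_frechet2 T (\<lambda>l h t. e (eta l h t)) (xi l) l"
  unfolding H1_frechet2_def
proof (intro conjI xi_bilinop l allI impI)
  fix \<epsilon> :: real assume \<epsilon>: "\<epsilon> > 0"
  \<comment> \<open>Coefficients of \<open>xi_remainder\<close> after replacing supremum bounds by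
    \<open>emb_const\<close> times H1 norms: \<open>\<kappa>1\<close> carries the Taylor term,
    \<open>\<kappa>2\<close> the two terms quadratic in h.\<close>
  define \<kappa>1 where "\<kappa>1 = sqrt (2 * T) * G * (P * emb_const * C * P * emb_const)"
  define \<kappa>2 where "\<kappa>2 = sqrt (2 * T) * G
    * (C * C * G * P * emb_const * C * P * emb_const * C * P * emb_const
      + C * C * P * emb_const * C * G * C * P * emb_const * P * emb_const)"
  have \<kappa>: "\<kappa>1 \<ge> 0" "\<kappa>2 \<ge> 0"
    unfolding \<kappa>1_def \<kappa>2_def using T_pos
    by (intro mult_nonneg_nonneg add_nonneg_nonneg C_pos G_nonneg P_nonneg emb_const_nonneg; simp)+
  obtain \<omega> \<delta> where \<delta>: "\<delta> > 0" and small: "\<And>N. 0 \<le> N \<Longrightarrow> N < \<delta> \<Longrightarrow> \<kappa>1 * \<omega> + \<kappa>2 * N \<le> \<epsilon>"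
    and \<omega>: "\<And>N t x. N < \<delta> \<Longrightarrow> t \<in> {0..T} \<Longrightarrow> norm (x - y l t) \<le> P * (emb_const * N) \<Longrightarrow>
      norm (A2 x - A2 (y l t)) \<le> \<omega>"
    using A2_modulus_small[OF l \<epsilon> \<kappa>] by metis
  show "\<exists>\<delta>>0. \<forall>h\<in>H1 T. H1norm T h < \<delta> \<longrightarrow> (\<forall>k\<in>H1 T.
      H1norm T (\<lambda>t. e (eta (\<lambda>s. l s + h s) k t) - e (eta l k t) - xi l h k t) \<le> \<epsilon> * H1norm T h * H1norm T k)"
  proof (intro exI[of _ \<delta>] conjI ballI impI \<delta>)
    fix h k :: "real \<Rightarrow> 'x" assume h: "h \<in> H1 T" and N: "H1norm T h < \<delta>" and k: "k \<in> H1 T"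
    have "H1norm T (\<lambda>t. e (eta (\<lambda>s. l s + h s) k t) - e (eta l k t) - xi l h k t)
        \<le> (\<kappa>1 * \<omega> + \<kappa>2 * H1norm T h) * (H1norm T h * H1norm T k)"
      by (rule order_trans[OF xi_remainder[OF l h k sup_bound[OF h] sup_bound[OF k] \<omega>[OF N]]])
        (simp_all add: \<kappa>1_def \<kappa>2_def algebra_simps)
    also have "\<dots> \<le> \<epsilon> * (H1norm T h * H1norm T k)"
      by (intro mult_right_mono small mult_nonneg_nonneg H1norm_nonneg N)
    finally show "H1norm T (\<lambda>t. e (eta (\<lambda>s. l s + h s) k t) - e (eta l k t) - xi l h k t)
        \<le> \<epsilon> * H1norm T h * H1norm T k"
      by (simp add: mult.assoc)
  qed
qed

lemma second_derivative_continuous: "H1_bilin_continuous T xi"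
  unfolding H1_bilin_continuous_def
proof (intro ballI allI impI)
  fix l :: "real \<Rightarrow> 'x" and \<epsilon> :: real assume l: "l \<in> H1 T" and \<epsilon>: "\<epsilon> > 0"
  define \<kappa>1 where "\<kappa>1 = sqrt (2 * T) * G * (P * emb_const * P * emb_const)"
  \<comment> \<open>The last three summands of \<open>xi_continuity\<close> agree up to the order of
    factors, hence the 3.\<close>
  define \<kappa>2 where "\<kappa>2 = sqrt (2 * T) * G * (3 * C * C * G * C * P * emb_const * P * emb_const * P * emb_const)"
  have \<kappa>: "\<kappa>1 \<ge> 0" "\<kappa>2 \<ge> 0"
    unfolding \<kappa>1_def \<kappa>2_def using T_pos
    by (intro mult_nonneg_nonneg C_pos G_nonneg P_nonneg emb_const_nonneg; simp)+
  obtain \<omega> \<delta> where \<delta>: "\<delta> > 0" and small: "\<And>N. 0 \<le> N \<Longrightarrow> N < \<delta> \<Longrightarrow> \<kappa>1 * \<omega> + \<kappa>2 * N \<le> \<epsilon>"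
    and \<omega>: "\<And>N t x. N < \<delta> \<Longrightarrow> t \<in> {0..T} \<Longrightarrow> norm (x - y l t) \<le> P * (emb_const * N) \<Longrightarrow>
      norm (A2 x - A2 (y l t)) \<le> \<omega>"
    using A2_modulus_small[OF l \<epsilon> \<kappa>] by metis
  show "\<exists>\<delta>>0. \<forall>l'\<in>H1 T. H1norm T (\<lambda>t. l' t - l t) < \<delta> \<longrightarrow> (\<forall>h\<in>H1 T. \<forall>k\<in>H1 T.
      H1norm T (\<lambda>t. xi l' h k t - xi l h k t) \<le> \<epsilon> * H1norm T h * H1norm T k)"
  proof (intro exI[of _ \<delta>] conjI ballI impI \<delta>)
    fix l' h k :: "real \<Rightarrow> 'x"
    let ?N = "H1norm T (\<lambda>t. l' t - l t)"
    assume l': "l' \<in> H1 T" and N: "?N < \<delta>" and h: "h \<in> H1 T" and k: "k \<in> H1 T"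
    have "H1norm T (\<lambda>t. xi l' h k t - xi l h k t) \<le> (\<kappa>1 * \<omega> + \<kappa>2 * ?N) * (H1norm T h * H1norm T k)"
      by (rule order_trans[OF xi_continuity[OF l l' h k sup_bound_diff[OF l l'] sup_bound[OF h]
              sup_bound[OF k] \<omega>[OF N]]])
        (simp_all add: \<kappa>1_def \<kappa>2_def algebra_simps)
    also have "\<dots> \<le> \<epsilon> * (H1norm T h * H1norm T k)"
      by (intro mult_right_mono small mult_nonneg_nonneg H1norm_nonneg N)
    finally show "H1norm T (\<lambda>t. xi l' h k t - xi l h k t) \<le> \<epsilon> * H1norm T h * H1norm T k"
      by (simp add: mult.assoc)
  qed
qed

text \<open>The theorem quantifies over arbitrary solutions of the first linearised equation,
  whereas \<open>xi\<close> is built from the chosen \<open>eta\<close>; uniqueness makes the two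
  right-hand sides agree on \<open>{0..T}\<close>.\<close>

lemma xi_sol_iff:
  assumes l: "l \<in> H1 T" and h: "h \<in> H1 T" and k: "k \<in> H1 T"
    and \<eta>: "eta_sol l h \<eta>1" "eta_sol l k \<eta>2"
  shows "xi_sol l h k \<xi> \<longleftrightarrow> \<xi> 0 = 0 \<and> H1_deriv T \<xi> (\<lambda>t. A2 (y l t) (eYZ (R (h t)) - QZ (\<eta>1 t))
    (eYZ (R (k t)) - QZ (\<eta>2 t)) - A1W (y l t) (Q (\<xi> t)))"
  unfolding xi_sol_def p_def using eta_unique[OF eta_sol_eta[OF l h] \<eta>(1)] eta_unique[OF eta_sol_eta[OF l k] \<eta>(2)]
  by (intro conj_cong refl H1_deriv_cong[OF T_nonneg]) simp_all

end

section \<open>The theorem\<close>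

theorem mainTheorem14:
  fixes T :: real
    and eYZ :: "'y::banach \<Rightarrow>\<^sub>L 'z::banach"
    and eZH :: "'z \<Rightarrow>\<^sub>L 'h::{real_inner, complete_space, second_countable_topology}"
    and eHW :: "'h \<Rightarrow>\<^sub>L 'w::banach"
    and R :: "'x::banach \<Rightarrow>\<^sub>L 'y"
    and Q :: "'w \<Rightarrow>\<^sub>L 'w" and QH :: "'h \<Rightarrow>\<^sub>L 'h" and QZ :: "'z \<Rightarrow>\<^sub>L 'z" and QY :: "'y \<Rightarrow>\<^sub>L 'y"
    and A :: "'y \<Rightarrow> 'y"
    and A1Z :: "'y \<Rightarrow> ('z \<Rightarrow>\<^sub>L 'z)" and A1H :: "'y \<Rightarrow> ('h \<Rightarrow>\<^sub>L 'h)" and A1W :: "'y \<Rightarrow> ('w \<Rightarrow>\<^sub>L 'w)"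
    and A2 :: "'y \<Rightarrow> ('z \<Rightarrow>\<^sub>L ('z \<Rightarrow>\<^sub>L 'w))"
    and z0 :: 'y
  assumes T_pos: "T > 0"
    (* continuous embeddings Y \<hookrightarrow> Z \<hookrightarrow> H \<hookrightarrow> W *)
    and emb: "inj (blinfun_apply eYZ)" "inj (blinfun_apply eZH)" "inj (blinfun_apply eHW)"
    (* Q restricts boundedly to H, Z, Y *)
    and QH: "\<And>h. eHW (QH h) = Q (eHW h)"
    and QZ: "\<And>z. eZH (QZ z) = QH (eZH z)"
    and QY: "\<And>y. eYZ (QY y) = QZ (eYZ y)"
    (* Assumption (D) *)
    and D_lip: "\<exists>L. \<forall>y1 y2. norm (A y1 - A y2) \<le> L * norm (y1 - y2)"
    and D_deriv: "\<And>y. ((\<lambda>y. eYZ (A y)) has_derivative (\<lambda>k. A1Z y (eYZ k))) (at y)"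
    and D_extH: "\<And>y z. A1H y (eZH z) = eZH (A1Z y z)"
    and D_bound: "\<exists>C. \<forall>y. (\<forall>z. norm (A1Z y z) \<le> C * norm z) \<and> (\<forall>h. norm (A1H y h) \<le> C * norm h)"
    (* Assumption (D2)(i) *)
    and D2_lipZ: "\<exists>L. \<forall>y1 y2. norm (A1Z y1 - A1Z y2) \<le> L * norm (y1 - y2)"
    and D2_extW: "\<And>y z. A1W y (eHW (eZH z)) = eHW (eZH (A1Z y z))"
    and D2_lipW: "\<exists>L. \<forall>y1 y2. norm (A1W y1 - A1W y2) \<le> L * norm (y1 - y2)"
    and D2_boundW: "\<exists>C. \<forall>y w. norm (A1W y w) \<le> C * norm w"
    (* Assumption (D2)(ii) *)
    and D2_deriv: "\<And>y. ((\<lambda>y. (eHW o\<^sub>L eZH) o\<^sub>L A1Z y) has_derivative (\<lambda>k. A2 y (eYZ k))) (at y)"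
    and D2_cont: "continuous_on UNIV A2"
    and D2_bound2: "\<exists>C. \<forall>y z1 z2. norm (A2 y z1 z2) \<le> C * norm z1 * norm z2"
  shows "\<exists>(D1 :: (real \<Rightarrow> 'x) \<Rightarrow> (real \<Rightarrow> 'x) \<Rightarrow> (real \<Rightarrow> 'w))
          (D2 :: (real \<Rightarrow> 'x) \<Rightarrow> (real \<Rightarrow> 'x) \<Rightarrow> (real \<Rightarrow> 'x) \<Rightarrow> (real \<Rightarrow> 'w)).
     (\<forall>l\<in>H1 T. H1_frechet T (\<lambda>l t. (eHW o\<^sub>L eZH o\<^sub>L eYZ) (sol_op T A R QY z0 l t)) (D1 l) l) \<and>
     (\<forall>l\<in>H1 T. H1_frechet2 T D1 (D2 l) l) \<and>
     H1_bilin_continuous T D2 \<and>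
     (\<forall>l\<in>H1 T. \<forall>h\<in>H1 T.
        (\<exists>\<eta> :: real \<Rightarrow> 'z. \<eta> 0 = 0 \<and>
            H1_deriv T \<eta> (\<lambda>t. A1Z (R (l t) - QY (sol_op T A R QY z0 l t))
                                  (eYZ (R (h t)) - QZ (\<eta> t)))) \<and>
        (\<forall>\<eta> :: real \<Rightarrow> 'z. \<eta> 0 = 0 \<and>
            H1_deriv T \<eta> (\<lambda>t. A1Z (R (l t) - QY (sol_op T A R QY z0 l t))
                                  (eYZ (R (h t)) - QZ (\<eta> t)))
          \<longrightarrow> eq_on T (D1 l h) (\<lambda>t. eHW (eZH (\<eta> t))))) \<and>
     (\<forall>l\<in>H1 T. \<forall>h1\<in>H1 T. \<forall>h2\<in>H1 T. \<forall>\<eta>1 \<eta>2 :: real \<Rightarrow> 'z.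
        (\<eta>1 0 = 0 \<and> H1_deriv T \<eta>1 (\<lambda>t. A1Z (R (l t) - QY (sol_op T A R QY z0 l t))
                                  (eYZ (R (h1 t)) - QZ (\<eta>1 t)))) \<and>
        (\<eta>2 0 = 0 \<and> H1_deriv T \<eta>2 (\<lambda>t. A1Z (R (l t) - QY (sol_op T A R QY z0 l t))
                                  (eYZ (R (h2 t)) - QZ (\<eta>2 t))))
        \<longrightarrow>
        (D2 l h1 h2 0 = 0 \<and>
         H1_deriv T (D2 l h1 h2) (\<lambda>t.
            A2 (R (l t) - QY (sol_op T A R QY z0 l t))
               (eYZ (R (h1 t)) - QZ (\<eta>1 t)) (eYZ (R (h2 t)) - QZ (\<eta>2 t))
            - A1W (R (l t) - QY (sol_op T A R QY z0 l t)) (Q (D2 l h1 h2 t)))) \<and>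
        (\<forall>\<xi> :: real \<Rightarrow> 'w. \<xi> 0 = 0 \<and>
            H1_deriv T \<xi> (\<lambda>t.
              A2 (R (l t) - QY (sol_op T A R QY z0 l t))
                 (eYZ (R (h1 t)) - QZ (\<eta>1 t)) (eYZ (R (h2 t)) - QZ (\<eta>2 t))
              - A1W (R (l t) - QY (sol_op T A R QY z0 l t)) (Q (\<xi> t)))
          \<longrightarrow> eq_on T \<xi> (D2 l h1 h2))) \<and>
     (\<exists>C. \<forall>l\<in>H1 T. \<forall>h1\<in>H1 T. \<forall>h2\<in>H1 T.
        H1norm T (D2 l h1 h2) \<le> C * H1norm T h1 * H1norm T h2)"
proof -
  obtain La where La: "\<And>y1 y2. norm (A y1 - A y2) \<le> La * norm (y1 - y2)"
    using D_lip by blast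
  obtain Cz where Cz: "\<And>y z. norm (A1Z y z) \<le> Cz * norm z"
    using D_bound by blast
  obtain Lz where Lz: "\<And>y1 y2. norm (A1Z y1 - A1Z y2) \<le> Lz * norm (y1 - y2)"
    using D2_lipZ by blast
  obtain Lw where Lw: "\<And>y1 y2. norm (A1W y1 - A1W y2) \<le> Lw * norm (y1 - y2)"
    using D2_lipW by blast
  obtain Cw where Cw: "\<And>y w. norm (A1W y w) \<le> Cw * norm w"
    using D2_boundW by blast
  obtain C2 where C2: "\<And>y z1 z2. norm (A2 y z1 z2) \<le> C2 * norm z1 * norm z2"
    using D2_bound2 by blast
  let ?e = "eHW o\<^sub>L eZH"
  \<comment> \<open>Absolute values, because constants supplied by the hypotheses may be negative;
    the leading 1 gives \<open>C \<ge> 1\<close>.\<close>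
  define C where "C = 1 + \<bar>La\<bar> + \<bar>Cz\<bar> + \<bar>Lz\<bar> + \<bar>Lw\<bar> + \<bar>Cw\<bar> + \<bar>C2\<bar>
    + norm R + norm eYZ + norm ?e + norm Q + norm QZ + norm QY"
  note nn = norm_ge_zero[of R] norm_ge_zero[of eYZ] norm_ge_zero[of ?e] norm_ge_zero[of Q]
    norm_ge_zero[of QZ] norm_ge_zero[of QY]
  have C_ge: "1 \<le> C" "La \<le> C" "Cz \<le> C" "Lz \<le> C" "Lw \<le> C" "Cw \<le> C" "C2 \<le> C"
    "norm R \<le> C" "norm eYZ \<le> C" "norm ?e \<le> C" "norm Q \<le> C" "norm QZ \<le> C" "norm QY \<le> C"
    unfolding C_def using nn by linarith+
  have lift: "a \<le> c * norm u \<Longrightarrow> c \<le> C \<Longrightarrow> a \<le> C * norm u" for a c and u :: "'v::real_normed_vector"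
    by (meson mult_right_mono norm_ge_zero order_trans)
  interpret evolution T C eYZ ?e R Q QZ QY A A1Z A1W A2 z0
  proof unfold_locales
    show "norm (A1Z y) \<le> C" for y
      using lift[OF Cz C_ge(3)] C_ge(1) by (intro norm_blinfun_bound) auto
    show "norm (A1W y) \<le> C" for y
      using lift[OF Cw C_ge(6)] C_ge(1) by (intro norm_blinfun_bound) auto
    show "norm (A2 y) \<le> C" for y
    proof (intro norm_blinfun_bound)
      fix z1 z2 :: 'z
      have "C2 * norm z1 * norm z2 \<le> C * norm z1 * norm z2"
        by (intro mult_right_mono C_ge norm_ge_zero)
      then show "norm (A2 y z1 z2) \<le> C * norm z1 * norm z2"
        by (rule order_trans[OF C2])
    qed (use C_ge(1) in auto)
  qed (use T_pos C_ge QH QZ QY D2_extW D_deriv D2_deriv D2_cont lift[OF La] lift[OF Lz] lift[OF Lw]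
      in \<open>simp_all\<close>)
  have eta_sol_iff: "eta_sol l h \<eta> \<longleftrightarrow> \<eta> 0 = 0 \<and>
      H1_deriv T \<eta> (\<lambda>t. A1Z (R (l t) - QY (sol_op T A R QY z0 l t)) (eYZ (R (h t)) - QZ (\<eta> t)))" for l h \<eta>
    by (simp add: eta_sol_def y_def)
  show ?thesis
    unfolding eta_sol_iff[symmetric]
  proof (intro exI[of _ "\<lambda>l h t. ?e (eta l h t)"] exI[of _ xi] conjI ballI allI impI)
    fix l :: "real \<Rightarrow> 'x" assume l: "l \<in> H1 T"
    show "H1_frechet T (\<lambda>l t. (eHW o\<^sub>L eZH o\<^sub>L eYZ) (sol_op T A R QY z0 l t)) (\<lambda>h t. ?e (eta l h t)) l"
      using solution_frechet[OF l] by simp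
    show "H1_frechet2 T (\<lambda>l h t. ?e (eta l h t)) (xi l) l"
      by (rule derivative_frechet[OF l])
  next
    show "H1_bilin_continuous T xi" by (rule second_derivative_continuous)
  next
    fix l h :: "real \<Rightarrow> 'x" assume l: "l \<in> H1 T" and h: "h \<in> H1 T"
    show "\<exists>\<eta>. eta_sol l h \<eta>" using eta_sol_eta[OF l h] by blast
    fix \<eta> assume "eta_sol l h \<eta>"
    from eta_unique[OF eta_sol_eta[OF l h] this]
    show "eq_on T (\<lambda>t. ?e (eta l h t)) (\<lambda>t. eHW (eZH (\<eta> t)))"
      by (simp add: eq_on_def)
  next
    fix l h1 h2 :: "real \<Rightarrow> 'x" and \<eta>1 \<eta>2 :: "real \<Rightarrow> 'z"
    assume l: "l \<in> H1 T" and h: "h1 \<in> H1 T" "h2 \<in> H1 T"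
      and \<eta>: "eta_sol l h1 \<eta>1 \<and> eta_sol l h2 \<eta>2"
    note iff = xi_sol_iff[OF l h conjunct1[OF \<eta>] conjunct2[OF \<eta>], unfolded y_def, symmetric]
    show "xi l h1 h2 0 = 0" by (rule xi_0[OF l h])
    show "H1_deriv T (xi l h1 h2) (\<lambda>t. A2 (R (l t) - QY (sol_op T A R QY z0 l t))
        (eYZ (R (h1 t)) - QZ (\<eta>1 t)) (eYZ (R (h2 t)) - QZ (\<eta>2 t))
        - A1W (R (l t) - QY (sol_op T A R QY z0 l t)) (Q (xi l h1 h2 t)))"
      using xi_sol_xi[OF l h] iff by blast
    fix \<xi>
    assume "\<xi> 0 = 0 \<and> H1_deriv T \<xi> (\<lambda>t. A2 (R (l t) - QY (sol_op T A R QY z0 l t))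
        (eYZ (R (h1 t)) - QZ (\<eta>1 t)) (eYZ (R (h2 t)) - QZ (\<eta>2 t))
        - A1W (R (l t) - QY (sol_op T A R QY z0 l t)) (Q (\<xi> t)))"
    then have "xi_sol l h1 h2 \<xi>" using iff by blast
    then show "eq_on T \<xi> (xi l h1 h2)"
      unfolding eq_on_def using xi_unique xi_sol_xi[OF l h] by blast
  next
    show "\<exists>C. \<forall>l\<in>H1 T. \<forall>h1\<in>H1 T. \<forall>h2\<in>H1 T.
        H1norm T (xi l h1 h2) \<le> C * H1norm T h1 * H1norm T h2"
      using xi_H1_bound by blast
  qed
qed

end
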